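(* Let $\varphi:\mathbb{R}_+\to\mathbb{R}_+$ be any continuous strictly increasing function (not necessarily convex). There is an algorithm that, given a positive integer $n$ and a probability vector $\boldsymbol{p}=(p_1,\dots,p_n)$ with $p_1\ge p_2\ge\dots\ge p_n>0$, outputs a binary prefix code for $n$ symbols whose codeword lengths $l_1,\dots,l_n$ minimize $$L(\boldsymbol{p},\boldsymbol{l},\varphi)=\varphi^{-1}\left(\sum_{i=1}^n p_i\,\varphi(l_i)\right)$$ among all binary prefix codes for $n$ symbols, and that runs in $O(n^4)$ time and $O(n^3)$ space.
   Context: A binary prefix code for $n$ symbols assigns to each symbol $i\in\{1,\dots,n\}$ a binary codeword of length $l_i\in\mathbb{Z}_+$ (positive integers) so that no codeword is a prefix of another; lengths $l_1,\dots,l_n$ are realizable if and only if the Kraft inequality $\sum_{i=1}^n 2^{-l_i}\le 1$ holds. Minimizing $L(\boldsymbol{p},\boldsymbol{l},\varphi)$ over such codes is Campbell's quasiarithmetic prefix coding problem with cost function $\varphi$. Computational model: arithmetic operations on real numbers and integers (including comparisons and bit shifts) and evaluation of $\varphi$ at an integer take constant time, and each stored number takes unit space. *)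

theory Defs
  imports "HOL-Analysis.Analysis" "HOL-Library.Landau_Symbols" "HOL-Library.Sublist"
begin

section \<open>Prefix codes and Campbell's cost\<close>

text \<open>Symbols are numbered \<open>1, ..., n\<close>; the values of the functions below at other indices are
  irrelevant.  Codeword lengths are positive, also for \<open>n = 1\<close>.\<close>

definition prefix_code :: "nat \<Rightarrow> (nat \<Rightarrow> bool list) \<Rightarrow> bool" where
  "prefix_code n w \<longleftrightarrow>
     (\<forall>i\<in>{1..n}. w i \<noteq> []) \<and>
     (\<forall>i\<in>{1..n}. \<forall>j\<in>{1..n}. i \<noteq> j \<longrightarrow> \<not> prefix (w i) (w j))"

definition cost_function :: "(real \<Rightarrow> real) \<Rightarrow> bool" where
  "cost_function \<phi> \<longleftrightarrow>
     \<phi> ` {0<..} \<subseteq> {0<..} \<and> continuous_on {0<..} \<phi> \<and> strict_mono_on {0<..} \<phi>"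

definition prob_vector :: "nat \<Rightarrow> (nat \<Rightarrow> real) \<Rightarrow> bool" where
  "prob_vector n p \<longleftrightarrow> (\<forall>i\<in>{1..n}. 0 \<le> p i) \<and> (\<Sum>i=1..n. p i) = 1"

text \<open>By continuity, the weighted mean of the values \<open>\<phi> (l i)\<close> lies in the range of \<open>\<phi>\<close> on
  the positive reals, so that \<open>inv_into\<close> is only applied where it is meaningful.\<close>

definition campbell_cost ::
  "nat \<Rightarrow> (nat \<Rightarrow> real) \<Rightarrow> (nat \<Rightarrow> nat) \<Rightarrow> (real \<Rightarrow> real) \<Rightarrow> real" where
  "campbell_cost n p l \<phi> = inv_into {0<..} \<phi> (\<Sum>i=1..n. p i * \<phi> (real (l i)))"

definition optimal_code ::
  "nat \<Rightarrow> (nat \<Rightarrow> real) \<Rightarrow> (real \<Rightarrow> real) \<Rightarrow> (nat \<Rightarrow> bool list) \<Rightarrow> bool" where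
  "optimal_code n p \<phi> w \<longleftrightarrow> prefix_code n w \<and>
     (\<forall>w'. prefix_code n w' \<longrightarrow>
        campbell_cost n p (\<lambda>i. length (w i)) \<phi> \<le> campbell_cost n p (\<lambda>i. length (w' i)) \<phi>)"

section \<open>The computational model\<close>

text \<open>A program is a while-program over finitely many named arrays of integers (names in
  \<open>'i\<close>) and of reals (names in \<open>'r\<close>); a scalar variable is an array used at index 0 only.
  Arithmetic, comparisons, shifts and the evaluation of \<open>\<phi>\<close> at an integer are the only
  operations.  There are no real literals, no rounding of reals, and no access to \<open>\<phi>\<close> other
  than \<open>RPhi\<close>.\<close>

datatype 'i iexp =
    IConst int
  | IRead 'i "'i iexp"
  | IAdd "'i iexp" "'i iexp"
  | ISub "'i iexp" "'i iexp"
  | IMul "'i iexp" "'i iexp"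
  | IDiv "'i iexp" "'i iexp"
  | IShl "'i iexp" "'i iexp"
  | IShr "'i iexp" "'i iexp"

datatype ('i, 'r) rexp =
    RRead 'r "'i iexp"
  | ROfInt "'i iexp"
  | RAdd "('i, 'r) rexp" "('i, 'r) rexp"
  | RSub "('i, 'r) rexp" "('i, 'r) rexp"
  | RMul "('i, 'r) rexp" "('i, 'r) rexp"
  | RDiv "('i, 'r) rexp" "('i, 'r) rexp"
  | RPhi "'i iexp"

datatype ('i, 'r) bexp =
    BLessI "'i iexp" "'i iexp"
  | BLessR "('i, 'r) rexp" "('i, 'r) rexp"
  | BNot "('i, 'r) bexp"
  | BAnd "('i, 'r) bexp" "('i, 'r) bexp"

datatype (iarrays: 'i, rarrays: 'r) com =
    Skip
  | IWrite 'i "'i iexp" "'i iexp"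
  | RWrite 'r "'i iexp" "('i, 'r) rexp"
  | Emit "'i iexp"
  | Seq "('i, 'r) com" "('i, 'r) com"
  | Cond "('i, 'r) bexp" "('i, 'r) com" "('i, 'r) com"
  | While "('i, 'r) bexp" "('i, 'r) com"

lemma finite_iarrays: "finite (iarrays c)" and finite_rarrays: "finite (rarrays c)"
proof -
  have i: "finite (set_iexp e)" for e :: "'a iexp"
    by (induction e) auto
  have r: "finite (set1_rexp e) \<and> finite (set2_rexp e)" for e :: "('a, 'b) rexp"
    by (induction e) (auto simp: i)
  have b: "finite (set1_bexp e) \<and> finite (set2_bexp e)" for e :: "('a, 'b) bexp"
    by (induction e) (auto simp: i r)
  show "finite (iarrays c)" "finite (rarrays c)"
    by (induction c) (auto simp: i r b)
qed

type_synonym program = "(string, string) com"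

record state =
  ints :: "string \<Rightarrow> int \<Rightarrow> int"
  reals :: "string \<Rightarrow> int \<Rightarrow> real"
  emitted :: "int list"

subsection \<open>Values\<close>

primrec ival :: "state \<Rightarrow> string iexp \<Rightarrow> int" where
  "ival s (IConst k) = k"
| "ival s (IRead a e) = ints s a (ival s e)"
| "ival s (IAdd e f) = ival s e + ival s f"
| "ival s (ISub e f) = ival s e - ival s f"
| "ival s (IMul e f) = ival s e * ival s f"
| "ival s (IDiv e f) = ival s e div ival s f"
| "ival s (IShl e f) = push_bit (nat (ival s f)) (ival s e)"
| "ival s (IShr e f) = drop_bit (nat (ival s f)) (ival s e)"

primrec rval :: "(real \<Rightarrow> real) \<Rightarrow> state \<Rightarrow> (string, string) rexp \<Rightarrow> real" where
  "rval \<phi> s (RRead a e) = reals s a (ival s e)"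
| "rval \<phi> s (ROfInt e) = real_of_int (ival s e)"
| "rval \<phi> s (RAdd e f) = rval \<phi> s e + rval \<phi> s f"
| "rval \<phi> s (RSub e f) = rval \<phi> s e - rval \<phi> s f"
| "rval \<phi> s (RMul e f) = rval \<phi> s e * rval \<phi> s f"
| "rval \<phi> s (RDiv e f) = rval \<phi> s e / rval \<phi> s f"
| "rval \<phi> s (RPhi e) = \<phi> (real_of_int (ival s e))"

primrec bval :: "(real \<Rightarrow> real) \<Rightarrow> state \<Rightarrow> (string, string) bexp \<Rightarrow> bool" where
  "bval \<phi> s (BLessI e f) \<longleftrightarrow> ival s e < ival s f"
| "bval \<phi> s (BLessR e f) \<longleftrightarrow> rval \<phi> s e < rval \<phi> s f"
| "bval \<phi> s (BNot b) \<longleftrightarrow> \<not> bval \<phi> s b"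
| "bval \<phi> s (BAnd b c) \<longleftrightarrow> bval \<phi> s b \<and> bval \<phi> s c"

subsection \<open>Safety\<close>

text \<open>An evaluation that is not safe makes the program get stuck.  Array indices have to lie in
  \<open>{0..<m}\<close>, where \<open>m\<close> is the available length of each array; divisors have to be nonzero,
  shift amounts nonnegative, and \<open>\<phi>\<close> can be evaluated at positive integers only.\<close>

primrec isafe :: "nat \<Rightarrow> state \<Rightarrow> string iexp \<Rightarrow> bool" where
  "isafe m s (IConst k) \<longleftrightarrow> True"
| "isafe m s (IRead a e) \<longleftrightarrow> isafe m s e \<and> 0 \<le> ival s e \<and> ival s e < int m"
| "isafe m s (IAdd e f) \<longleftrightarrow> isafe m s e \<and> isafe m s f"
| "isafe m s (ISub e f) \<longleftrightarrow> isafe m s e \<and> isafe m s f"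
| "isafe m s (IMul e f) \<longleftrightarrow> isafe m s e \<and> isafe m s f"
| "isafe m s (IDiv e f) \<longleftrightarrow> isafe m s e \<and> isafe m s f \<and> ival s f \<noteq> 0"
| "isafe m s (IShl e f) \<longleftrightarrow> isafe m s e \<and> isafe m s f \<and> 0 \<le> ival s f"
| "isafe m s (IShr e f) \<longleftrightarrow> isafe m s e \<and> isafe m s f \<and> 0 \<le> ival s f"

primrec rsafe :: "(real \<Rightarrow> real) \<Rightarrow> nat \<Rightarrow> state \<Rightarrow> (string, string) rexp \<Rightarrow> bool" where
  "rsafe \<phi> m s (RRead a e) \<longleftrightarrow> isafe m s e \<and> 0 \<le> ival s e \<and> ival s e < int m"
| "rsafe \<phi> m s (ROfInt e) \<longleftrightarrow> isafe m s e"
| "rsafe \<phi> m s (RAdd e f) \<longleftrightarrow> rsafe \<phi> m s e \<and> rsafe \<phi> m s f"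
| "rsafe \<phi> m s (RSub e f) \<longleftrightarrow> rsafe \<phi> m s e \<and> rsafe \<phi> m s f"
| "rsafe \<phi> m s (RMul e f) \<longleftrightarrow> rsafe \<phi> m s e \<and> rsafe \<phi> m s f"
| "rsafe \<phi> m s (RDiv e f) \<longleftrightarrow> rsafe \<phi> m s e \<and> rsafe \<phi> m s f \<and> rval \<phi> s f \<noteq> 0"
| "rsafe \<phi> m s (RPhi e) \<longleftrightarrow> isafe m s e \<and> 0 < ival s e"

primrec bsafe :: "(real \<Rightarrow> real) \<Rightarrow> nat \<Rightarrow> state \<Rightarrow> (string, string) bexp \<Rightarrow> bool" where
  "bsafe \<phi> m s (BLessI e f) \<longleftrightarrow> isafe m s e \<and> isafe m s f"
| "bsafe \<phi> m s (BLessR e f) \<longleftrightarrow> rsafe \<phi> m s e \<and> rsafe \<phi> m s f"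
| "bsafe \<phi> m s (BNot b) \<longleftrightarrow> bsafe \<phi> m s b"
| "bsafe \<phi> m s (BAnd b c) \<longleftrightarrow> bsafe \<phi> m s b \<and> bsafe \<phi> m s c"

subsection \<open>Time\<close>

text \<open>Each literal, memory access, operation and control decision takes one unit of time.\<close>

primrec itime :: "'i iexp \<Rightarrow> nat" where
  "itime (IConst k) = 1"
| "itime (IRead a e) = itime e + 1"
| "itime (IAdd e f) = itime e + itime f + 1"
| "itime (ISub e f) = itime e + itime f + 1"
| "itime (IMul e f) = itime e + itime f + 1"
| "itime (IDiv e f) = itime e + itime f + 1"
| "itime (IShl e f) = itime e + itime f + 1"
| "itime (IShr e f) = itime e + itime f + 1"

primrec rtime :: "('i, 'r) rexp \<Rightarrow> nat" where
  "rtime (RRead a e) = itime e + 1"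
| "rtime (ROfInt e) = itime e + 1"
| "rtime (RAdd e f) = rtime e + rtime f + 1"
| "rtime (RSub e f) = rtime e + rtime f + 1"
| "rtime (RMul e f) = rtime e + rtime f + 1"
| "rtime (RDiv e f) = rtime e + rtime f + 1"
| "rtime (RPhi e) = itime e + 1"

primrec btime :: "('i, 'r) bexp \<Rightarrow> nat" where
  "btime (BLessI e f) = itime e + itime f + 1"
| "btime (BLessR e f) = rtime e + rtime f + 1"
| "btime (BNot b) = btime b + 1"
| "btime (BAnd b c) = btime b + btime c + 1"

subsection \<open>Execution\<close>

text \<open>\<open>exec \<phi> m c s t s'\<close>: started in \<open>s\<close>, the program \<open>c\<close> terminates in \<open>s'\<close> after \<open>t\<close> time
  units, and it accesses all its arrays at indices below \<open>m\<close> only.\<close>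

inductive exec ::
  "(real \<Rightarrow> real) \<Rightarrow> nat \<Rightarrow> program \<Rightarrow> state \<Rightarrow> nat \<Rightarrow> state \<Rightarrow> bool" for \<phi> m where
  Skip: "exec \<phi> m Skip s 1 s"
| IWrite: "\<lbrakk>isafe m s e; 0 \<le> ival s e; ival s e < int m; isafe m s f\<rbrakk> \<Longrightarrow>
    exec \<phi> m (IWrite a e f) s (itime e + itime f + 1)
      (s\<lparr>ints := (ints s)(a := (ints s a)(ival s e := ival s f))\<rparr>)"
| RWrite: "\<lbrakk>isafe m s e; 0 \<le> ival s e; ival s e < int m; rsafe \<phi> m s f\<rbrakk> \<Longrightarrow>
    exec \<phi> m (RWrite a e f) s (itime e + rtime f + 1)
      (s\<lparr>reals := (reals s)(a := (reals s a)(ival s e := rval \<phi> s f))\<rparr>)"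
| Emit: "isafe m s e \<Longrightarrow>
    exec \<phi> m (Emit e) s (itime e + 1) (s\<lparr>emitted := emitted s @ [ival s e]\<rparr>)"
| Seq: "\<lbrakk>exec \<phi> m c s t s'; exec \<phi> m d s' u s''\<rbrakk> \<Longrightarrow> exec \<phi> m (Seq c d) s (t + u) s''"
| CondTrue: "\<lbrakk>bsafe \<phi> m s b; bval \<phi> s b; exec \<phi> m c s t s'\<rbrakk> \<Longrightarrow>
    exec \<phi> m (Cond b c d) s (btime b + t + 1) s'"
| CondFalse: "\<lbrakk>bsafe \<phi> m s b; \<not> bval \<phi> s b; exec \<phi> m d s t s'\<rbrakk> \<Longrightarrow>
    exec \<phi> m (Cond b c d) s (btime b + t + 1) s'"
| WhileFalse: "\<lbrakk>bsafe \<phi> m s b; \<not> bval \<phi> s b\<rbrakk> \<Longrightarrow> exec \<phi> m (While b c) s (btime b + 1) s"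
| WhileTrue: "\<lbrakk>bsafe \<phi> m s b; bval \<phi> s b; exec \<phi> m c s t s'; exec \<phi> m (While b c) s' u s''\<rbrakk> \<Longrightarrow>
    exec \<phi> m (While b c) s (btime b + t + u + 1) s''"

text \<open>The input: \<open>n\<close> is entry 0 of the integer array \<open>n\<close>, and \<open>p i\<close> is entry \<open>i\<close> of the real
  array \<open>p\<close> for \<open>1 \<le> i \<le> n\<close>; everything else is 0.\<close>

definition initial_state :: "nat \<Rightarrow> (nat \<Rightarrow> real) \<Rightarrow> state" where
  "initial_state n p =
     \<lparr>ints = (\<lambda>a k. if a = ''n'' \<and> k = 0 then int n else 0),
      reals = (\<lambda>a k. if a = ''p'' \<and> 1 \<le> k \<and> k \<le> int n then p (nat k) else 0),
      emitted = []\<rparr>"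

text \<open>A code is written out bit by bit: for each symbol its codeword length followed by the bits
  of the codeword, one number per bit.\<close>

definition code_output :: "nat \<Rightarrow> (nat \<Rightarrow> bool list) \<Rightarrow> int list" where
  "code_output n w = concat (map (\<lambda>i. int (length (w i)) # map of_bool (w i)) [1..<Suc n])"

text \<open>The space consists of the first \<open>m\<close> entries of each array occurring in the program and of
  the output.  Since all entries up to the largest index count, sparsely used arrays do not
  save space.\<close>

definition outputs_code_within ::
  "(real \<Rightarrow> real) \<Rightarrow> program \<Rightarrow> nat \<Rightarrow> (nat \<Rightarrow> real) \<Rightarrow> real \<Rightarrow> real \<Rightarrow> (nat \<Rightarrow> bool list) \<Rightarrow> bool"
  where
  "outputs_code_within \<phi> c n p T S w \<longleftrightarrow>
     (\<exists>m t s. exec \<phi> m c (initial_state n p) t s \<and> emitted s = code_output n w \<and>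
        real t \<le> T \<and>
        real ((card (iarrays c) + card (rarrays c)) * m + length (emitted s)) \<le> S)"

end

theory Submission
  imports Defs
begin

text \<open>Build the code tree level by level.  A state consists of the current depth \<open>l\<close>, the number \<open>i\<close>
  of symbols that already have a codeword, and the number \<open>m \<le> n - i\<close> of free nodes of depth \<open>l\<close>;
  in each state either the next (most probable) symbol takes a free node, or all free nodes are
  split.  The first step increases \<open>i\<close> and decreases \<open>m\<close> by one, the second increases \<open>l\<close> by one and
  \<open>m\<close> by at least one, so \<open>l \<le> i + m \<le> n\<close> throughout.  The least costs to go from these \<open>O(n\<^sup>3)\<close>
  states are tabulated, and an optimal path through the table yields the code if the free nodes
  are used from left to right.  That no code is cheaper follows from Kraft's inequality and an
  exchange argument.\<close>

section \<open>Kraft's inequality\<close>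

text \<open>Extend every codeword in all possible ways to a common length \<open>L\<close>. Two
  prefixes of one word are comparable, so the sets of extensions are disjoint; counting them among
  the \<open>2 ^ L\<close> words of length \<open>L\<close> gives the bound.\<close>

lemma prefix_code_kraft:
  assumes "prefix_code n w"
  shows "(\<Sum>i=1..n. (1/2::real) ^ length (w i)) \<le> 1"
proof -
  \<comment> \<open>Any common upper bound of the lengths will do; the sum avoids a maximum over a
    possibly empty set.\<close>
  define L where "L = (\<Sum>i=1..n. length (w i))"
  have le: "length (w i) \<le> L" if "i \<in> {1..n}" for i
    unfolding L_def using that by (intro member_le_sum) auto
  define E where "E i = (\<lambda>y. w i @ y) ` {y :: bool list. length y = L - length (w i)}" for i
  have fin: "finite {y :: bool list. length y = k}" and card: "card {y :: bool list. length y = k} = 2 ^ k" for k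
    using finite_lists_length_eq[of "UNIV :: bool set" k] card_lists_length_eq[of "UNIV :: bool set" k] by auto
  have cE: "card (E i) = 2 ^ (L - length (w i))" for i
    unfolding E_def by (subst card_image) (auto simp: inj_on_def card)
  have disj: "E i \<inter> E j = {}" if "i \<in> {1..n}" "j \<in> {1..n}" "i \<noteq> j" for i j
  proof (rule ccontr)
    assume "E i \<inter> E j \<noteq> {}"
    then obtain x where "x \<in> E i" "x \<in> E j" by blast
    moreover have "prefix (w k) x" if "x \<in> E k" for k using that by (auto simp: E_def)
    ultimately have "prefix (w i) x" "prefix (w j) x" by auto
    with prefix_same_cases assms that show False unfolding prefix_code_def by metis
  qed
  have "(\<Sum>i=1..n. card (E i)) = card (\<Union>i\<in>{1..n}. E i)"
    using disj by (subst card_UN_disjoint) (auto simp: E_def fin)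
  also have "\<dots> \<le> card {y :: bool list. length y = L}"
    using le by (intro card_mono fin) (auto simp: E_def)
  finally have "(\<Sum>i=1..n. 2 ^ (L - length (w i))) \<le> (2 ^ L :: nat)" by (simp add: cE card)
  then have "real (\<Sum>i=1..n. 2 ^ (L - length (w i))) \<le> real (2 ^ L)" by (rule of_nat_mono)
  then have "(\<Sum>i=1..n. (2::real) ^ (L - length (w i))) \<le> 2 ^ L" by simp
  moreover have "(\<Sum>i=1..n. (2::real) ^ (L - length (w i))) = 2 ^ L * (\<Sum>i=1..n. (1/2) ^ length (w i))"
    unfolding sum_distrib_left
    by (intro sum.cong refl) (simp add: le power_diff power_one_over divide_simps)
  ultimately show ?thesis by simp
qed

lemma prefix_same_length: "\<lbrakk>prefix xs ys; length ys \<le> length xs\<rbrakk> \<Longrightarrow> xs = ys"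
  by (auto simp: prefix_def)

section \<open>Binary numerals of fixed length\<close>

text \<open>Most significant bit first: appending a bit passes from node \<open>x div 2\<close> of
  depth \<open>l\<close> to its child \<open>x\<close> of depth \<open>l + 1\<close>. Only
  \<open>x\<close> modulo \<open>2 ^ l\<close> matters.\<close>

primrec bits :: "nat \<Rightarrow> nat \<Rightarrow> bool list" where
  "bits 0 x = []"
| "bits (Suc l) x = bits l (x div 2) @ [odd x]"

lemma length_bits [simp]: "length (bits l x) = l"
  by (induction l arbitrary: x) auto

lemma bits_inject:
  "\<lbrakk>bits l x = bits l y; x < 2 ^ l; y < 2 ^ l\<rbrakk> \<Longrightarrow> x = y"
proof (induction l arbitrary: x y)
  case (Suc l)
  then have "x div 2 = y div 2" by (intro Suc.IH) auto
  moreover have "odd x = odd y" using Suc.prems by simp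
  ultimately show ?case
    by (metis even_iff_mod_2_eq_zero mod2_eq_if div_mult_mod_eq)
qed simp

section \<open>Program verification\<close>

text \<open>Total correctness from a fixed state. Time is only bounded from above, so that branches
  of different duration can share one bound.\<close>

definition runs ::
  "(real \<Rightarrow> real) \<Rightarrow> nat \<Rightarrow> program \<Rightarrow> state \<Rightarrow> nat \<Rightarrow> (state \<Rightarrow> bool) \<Rightarrow> bool" where
  "runs \<phi> B c s T Q \<longleftrightarrow> (\<exists>t s'. exec \<phi> B c s t s' \<and> t \<le> T \<and> Q s')"

lemma runs_mono:
  "\<lbrakk>runs \<phi> B c s T Q; T \<le> T'; \<And>s'. Q s' \<Longrightarrow> Q' s'\<rbrakk> \<Longrightarrow> runs \<phi> B c s T' Q'"
  unfolding runs_def by (meson order_trans)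

lemma runs_Seq:
  assumes "runs \<phi> B c s T R" "\<And>s'. R s' \<Longrightarrow> runs \<phi> B d s' U Q"
  shows "runs \<phi> B (Seq c d) s (T + U) Q"
  using assms unfolding runs_def by (meson add_mono exec.Seq)

lemma runs_Cond:
  assumes "bsafe \<phi> B s b"
    and "bval \<phi> s b \<Longrightarrow> runs \<phi> B c s T Q" "\<not> bval \<phi> s b \<Longrightarrow> runs \<phi> B d s T Q"
  shows "runs \<phi> B (Cond b c d) s (btime b + T + 1) Q"
proof (cases "bval \<phi> s b")
  case True
  with assms obtain t s' where "exec \<phi> B c s t s'" "t \<le> T" "Q s'" by (auto simp: runs_def)
  with exec.CondTrue[OF assms(1) True this(1), of d] show ?thesis
    unfolding runs_def by (intro exI[of _ "btime b + t + 1"] exI[of _ s']) auto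
next
  case False
  with assms obtain t s' where "exec \<phi> B d s t s'" "t \<le> T" "Q s'" by (auto simp: runs_def)
  with exec.CondFalse[OF assms(1) False this(1), of c] show ?thesis
    unfolding runs_def by (intro exI[of _ "btime b + t + 1"] exI[of _ s']) auto
qed

text \<open>The natural number \<open>f\<close> drops in every round, so there are at most
  \<open>f s\<close> rounds and \<open>f s + 1\<close> tests.\<close>

lemma runs_While:
  assumes safe: "\<And>s. I s \<Longrightarrow> bsafe \<phi> B s b"
    and step: "\<And>s. I s \<Longrightarrow> bval \<phi> s b \<Longrightarrow> runs \<phi> B c s K (\<lambda>s'. I s' \<and> f s' < f s)"
    and "I s"
  shows "runs \<phi> B (While b c) s ((f s + 1) * (btime b + K + 1)) (\<lambda>s'. I s' \<and> \<not> bval \<phi> s' b)"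
  using \<open>I s\<close>
proof (induction "f s" arbitrary: s rule: less_induct)
  case less
  note I = \<open>I s\<close>
  show ?case
  proof (cases "bval \<phi> s b")
    case False
    with exec.WhileFalse[OF safe[OF I] False, of c] I show ?thesis
      unfolding runs_def by (intro exI[of _ "btime b + 1"] exI[of _ s]) auto
  next
    case True
    from step[OF I True] obtain t s' where s': "exec \<phi> B c s t s'" "t \<le> K" "I s'" "f s' < f s"
      by (auto simp: runs_def)
    from less(1)[OF s'(4,3)] obtain u s'' where
      s'': "exec \<phi> B (While b c) s' u s''" "u \<le> (f s' + 1) * (btime b + K + 1)"
        "I s''" "\<not> bval \<phi> s'' b"
      by (auto simp: runs_def)
    \<comment> \<open>The drop of \<open>f\<close> by at least one pays for the current
      round.\<close>
    have "(f s' + 1) * (btime b + K + 1) \<le> f s * (btime b + K + 1)"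
      using s'(4) by (intro mult_right_mono) auto
    then have "btime b + t + u + 1 \<le> (f s + 1) * (btime b + K + 1)"
      using s'(2) s''(2) by (simp add: algebra_simps)
    with exec.WhileTrue[OF safe[OF I] True s'(1) s''(1)] s''(3,4) show ?thesis
      unfolding runs_def by blast
  qed
qed

text \<open>\<open>wp\<close> and \<open>time_bound\<close> are meant for loop-free programs only.\<close>

primrec wp :: "(real \<Rightarrow> real) \<Rightarrow> nat \<Rightarrow> program \<Rightarrow> (state \<Rightarrow> bool) \<Rightarrow> state \<Rightarrow> bool" where
  "wp \<phi> B Skip Q s \<longleftrightarrow> Q s"
| "wp \<phi> B (IWrite a e f) Q s \<longleftrightarrow>
     isafe B s e \<and> 0 \<le> ival s e \<and> ival s e < int B \<and> isafe B s f \<and>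
     Q (s\<lparr>ints := (ints s)(a := (ints s a)(ival s e := ival s f))\<rparr>)"
| "wp \<phi> B (RWrite a e f) Q s \<longleftrightarrow>
     isafe B s e \<and> 0 \<le> ival s e \<and> ival s e < int B \<and> rsafe \<phi> B s f \<and>
     Q (s\<lparr>reals := (reals s)(a := (reals s a)(ival s e := rval \<phi> s f))\<rparr>)"
| "wp \<phi> B (Emit e) Q s \<longleftrightarrow> isafe B s e \<and> Q (s\<lparr>emitted := emitted s @ [ival s e]\<rparr>)"
| "wp \<phi> B (Seq c d) Q s \<longleftrightarrow> wp \<phi> B c (wp \<phi> B d Q) s"
| "wp \<phi> B (Cond b c d) Q s \<longleftrightarrow>
     bsafe \<phi> B s b \<and> (if bval \<phi> s b then wp \<phi> B c Q s else wp \<phi> B d Q s)"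
| "wp \<phi> B (While b c) Q s \<longleftrightarrow> False"

primrec time_bound :: "program \<Rightarrow> nat" where
  "time_bound Skip = 1"
| "time_bound (IWrite a e f) = itime e + itime f + 1"
| "time_bound (RWrite a e f) = itime e + rtime f + 1"
| "time_bound (Emit e) = itime e + 1"
| "time_bound (Seq c d) = time_bound c + time_bound d"
| "time_bound (Cond b c d) = btime b + max (time_bound c) (time_bound d) + 1"
| "time_bound (While b c) = 0"

lemma wp_runs: "wp \<phi> B c Q s \<Longrightarrow> runs \<phi> B c s (time_bound c) Q"
proof (induction c arbitrary: Q s)
  case Skip
  then show ?case unfolding runs_def using exec.Skip by fastforce
next
  case (IWrite a e f)
  then show ?case unfolding runs_def using exec.IWrite[of B s e f \<phi> a] by fastforce
next
  case (RWrite a e f)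
  then show ?case unfolding runs_def using exec.RWrite[of B s e \<phi> f a] by fastforce
next
  case (Emit e)
  then show ?case unfolding runs_def using exec.Emit[of B s e \<phi>] by fastforce
next
  case (Seq c d)
  then show ?case using runs_Seq[of \<phi> B c s "time_bound c" "wp \<phi> B d Q"] by simp
next
  case (Cond b c d)
  show ?case unfolding time_bound.simps
    by (rule runs_Cond)
      (use Cond in \<open>auto intro: runs_mono[OF Cond.IH(1)] runs_mono[OF Cond.IH(2)]\<close>)
qed simp

lemma wp_mono: "\<lbrakk>wp \<phi> B c R s; \<And>s'. R s' \<Longrightarrow> Q s'\<rbrakk> \<Longrightarrow> wp \<phi> B c Q s"
proof (induction c arbitrary: R Q s)
  case (Seq c d)
  from Seq.prems(1) have "wp \<phi> B c (wp \<phi> B d R) s" by simp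
  then have "wp \<phi> B c (wp \<phi> B d Q) s"
    by (rule Seq.IH(1)) (rule Seq.IH(2)[OF _ Seq.prems(2)])
  then show ?case by simp
next
  case (Cond b c d)
  then show ?case by (auto split: if_splits)
qed auto

section \<open>The program\<close>

abbreviation var :: "string \<Rightarrow> string iexp" where
  "var a \<equiv> IRead a (IConst 0)"

abbreviation assign :: "string \<Rightarrow> string iexp \<Rightarrow> program" where
  "assign a e \<equiv> IWrite a (IConst 0) e"

abbreviation is_pos :: "string \<Rightarrow> (string, string) bexp" where
  "is_pos a \<equiv> BLessI (IConst 0) (var a)"

section \<open>Table indices and the choice between the two moves\<close>

definition side :: "string iexp" where
  "side = IAdd (var ''n'') (IConst 1)"

definition remaining :: "string iexp" where
  "remaining = ISub (var ''n'') (var ''i'')"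

text \<open>Row-major index of a state in a cube of side \<open>n + 1\<close>; the three coordinates
  are its digits in base \<open>n + 1\<close>.\<close>

definition slot :: "string iexp \<Rightarrow> string iexp \<Rightarrow> string iexp \<Rightarrow> string iexp" where
  "slot l i m = IAdd (IMul (IAdd (IMul l side) i) side) m"

definition take_value :: "(string, string) rexp" where
  "take_value =
     RAdd (RMul (RRead ''p'' (IAdd (var ''i'') (IConst 1))) (RPhi (var ''l'')))
       (RRead ''A'' (slot (var ''l'') (IAdd (var ''i'') (IConst 1)) (ISub (var ''m'') (IConst 1))))"

text \<open>Presupposes that \<open>k\<close> holds the capped node number computed by
  \<open>cap\<close>.\<close>

definition split_value :: "(string, string) rexp" where
  "split_value = RRead ''A'' (slot (IAdd (var ''l'') (IConst 1)) (var ''i'') (var ''k''))"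

text \<open>De Morgan form of: \<open>n - i <= m\<close>, or \<open>1 < m\<close> and taking costs
  no more than splitting. Safety of a conjunction demands safety of both sides, so the table reads
  must stay in range even where the integer comparisons alone decide.\<close>

definition take_test :: "(string, string) bexp" where
  "take_test =
     BNot (BAnd (BLessI (var ''m'') remaining)
       (BNot (BAnd (BLessI (IConst 1) (var ''m'')) (BNot (BLessR split_value take_value)))))"

definition cap :: program where
  "cap = Seq (assign ''k'' (IMul (IConst 2) (var ''m'')))
     (Cond (BLessI remaining (var ''k'')) (assign ''k'' remaining) Skip)"

text \<open>The digits of the decremented \<open>x\<close> in base \<open>n + 1\<close>; remainders
  have to be expressed through division.\<close>

definition decode :: program where
  "decode =
     Seq (assign ''x'' (ISub (var ''x'') (IConst 1)))
    (Seq (assign ''m'' (ISub (var ''x'') (IMul side (IDiv (var ''x'') side))))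
    (Seq (assign ''i'' (ISub (IDiv (var ''x'') side) (IMul side (IDiv (IDiv (var ''x'') side) side))))
      (assign ''l'' (IDiv (IDiv (var ''x'') side) side))))"

text \<open>The pass over the table decreases \<open>x\<close>, and both successors of a state have a larger index.
  The value written at indices that do not stand for a state is irrelevant unless \<open>m = 0\<close>
  and \<open>i = n\<close>, where \<open>0\<close> is the correct cost.\<close>

definition valid_test :: "(string, string) bexp" where
  "valid_test =
     BAnd (BAnd (is_pos ''m'') (is_pos ''l''))
       (BAnd (BNot (BLessI (IAdd (var ''i'') (var ''m'')) (var ''l'')))
         (BNot (BLessI (var ''n'') (IAdd (var ''i'') (var ''m'')))))"

definition fill_body :: program where
  "fill_body =
     Seq decode
       (Cond valid_test
         (Seq cap
           (Cond take_test
             (RWrite ''A'' (var ''x'') take_value)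
             (RWrite ''A'' (var ''x'') split_value)))
         (RWrite ''A'' (var ''x'') (ROfInt (IConst 0))))"

definition fill :: program where
  "fill = While (is_pos ''x'') fill_body"

text \<open>Shifting and reducing modulo 2 isolates one bit of \<open>c\<close>. As \<open>j\<close>
  counts down, the most significant bit comes first.\<close>

definition emit_body :: program where
  "emit_body =
     Seq (assign ''j'' (ISub (var ''j'') (IConst 1)))
       (Emit (ISub (IShr (var ''c'') (var ''j''))
         (IMul (IConst 2) (IDiv (IShr (var ''c'') (var ''j'')) (IConst 2)))))"

definition emit :: program where
  "emit = Seq (Seq (Emit (var ''l'')) (assign ''j'' (var ''l'')))
     (While (is_pos ''j'') emit_body)"

definition take_node :: program where
  "take_node =
     Seq (assign ''c'' (IAdd (var ''c'') (IConst 1)))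
    (Seq (assign ''i'' (IAdd (var ''i'') (IConst 1)))
      (assign ''m'' (ISub (var ''m'') (IConst 1))))"

text \<open>The leftmost free node \<open>c\<close> has the children \<open>2 * c\<close> and
  \<open>2 * c + 1\<close>, so the leftmost free node one level below is
  \<open>2 * c\<close>.\<close>

definition split_nodes :: program where
  "split_nodes =
     Seq (assign ''c'' (IMul (IConst 2) (var ''c'')))
    (Seq (assign ''l'' (IAdd (var ''l'') (IConst 1)))
      (assign ''m'' (var ''k'')))"

definition walk :: program where
  "walk = While (is_pos ''m'')
     (Seq cap (Cond take_test (Seq emit take_node) split_nodes))"

definition start_fill :: program where
  "start_fill = assign ''x'' (IMul side (IMul side side))"

text \<open>The walk starts below the root because codewords are nonempty; with a single symbol only
  one of the two children is useful.\<close>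

definition start_walk :: program where
  "start_walk =
     Seq (assign ''l'' (IConst 1))
    (Seq (assign ''i'' (IConst 0))
    (Seq (assign ''c'' (IConst 0))
      (Cond (BLessI (IConst 1) (var ''n'')) (assign ''m'' (IConst 2)) (assign ''m'' (IConst 1)))))"

definition campbell_program :: program where
  "campbell_program = Seq (Seq start_fill fill) (Seq start_walk walk)"

section \<open>Time budgets\<close>

definition emit_time :: "nat \<Rightarrow> nat" where
  "emit_time l = time_bound (Seq (Emit (var ''l'')) (assign ''j'' (var ''l''))) +
     (l + 1) * (btime (is_pos ''j'') + time_bound emit_body + 1)"

text \<open>The factors come from \<open>(n + 1) ^ 3 + 1 <= 9 * n ^ 4\<close> and
  \<open>2 * n + 1 <= 3 * n\<close>; \<open>emit_time 1\<close> enters because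
  \<open>emit_time n <= emit_time 1 * n\<close>.\<close>

definition time_constant :: nat where
  "time_constant = time_bound start_fill +
     9 * (btime (is_pos ''x'') + time_bound fill_body + 1) +
     time_bound start_walk +
     3 * (btime (is_pos ''m'') + time_bound cap + btime take_test +
       emit_time 1 + time_bound take_node + time_bound split_nodes + 2)"

section \<open>The dynamic program\<close>

locale campbell_problem =
  fixes \<phi> :: "real \<Rightarrow> real" and n :: nat and p :: "nat \<Rightarrow> real"
  assumes phi: "cost_function \<phi>"
    and n_pos: "n \<ge> 1"
    and prob: "prob_vector n p"
    and sorted: "\<And>i j. i \<in> {1..n} \<Longrightarrow> j \<in> {1..n} \<Longrightarrow> i \<le> j \<Longrightarrow> p j \<le> p i"
begin

section \<open>From the quasiarithmetic mean to the plain weighted sum\<close>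

lemma phi_mono: "0 < x \<Longrightarrow> x \<le> y \<Longrightarrow> \<phi> x \<le> \<phi> y"
  using phi strict_mono_onD[of "{0<..}" \<phi> x y] unfolding cost_function_def
  by (cases "x = y") auto

lemma p_nonneg: "i \<in> {1..n} \<Longrightarrow> 0 \<le> p i"
  using prob by (auto simp: prob_vector_def)

text \<open>By continuity the image of the positive reals under \<open>\<phi>\<close> is an
  interval, so it contains both weighted means. There \<open>inv_into\<close> is a genuine inverse,
  and it is monotone since \<open>\<phi>\<close> is strictly increasing.\<close>

lemma campbell_cost_mono:
  assumes "\<And>i. i \<in> {1..n} \<Longrightarrow> 0 < l i" "\<And>i. i \<in> {1..n} \<Longrightarrow> 0 < l' i"
    and le: "(\<Sum>i=1..n. p i * \<phi> (real (l i))) \<le> (\<Sum>i=1..n. p i * \<phi> (real (l' i)))"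
  shows "campbell_cost n p l \<phi> \<le> campbell_cost n p l' \<phi>"
proof -
  have "connected (\<phi> ` {0<..})"
    using phi by (intro connected_continuous_image) (auto simp: cost_function_def)
  then have cvx: "convex (\<phi> ` {0<..})"
    using is_interval_connected_1 is_interval_convex_1 by blast
  have range: "(\<Sum>i=1..n. p i * \<phi> (real (k i))) \<in> \<phi> ` {0<..}"
    if "\<And>i. i \<in> {1..n} \<Longrightarrow> 0 < k i" for k
    using convex_sum[OF _ cvx, of "{1..n}" p "\<lambda>i. \<phi> (real (k i))"] prob that
    by (auto simp: prob_vector_def)
  let ?a = "\<Sum>i=1..n. p i * \<phi> (real (l i))" and ?b = "\<Sum>i=1..n. p i * \<phi> (real (l' i))"
  have a: "?a \<in> \<phi> ` {0<..}" and b: "?b \<in> \<phi> ` {0<..}" using range assms by blast+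
  show ?thesis
  proof (rule ccontr)
    assume "\<not> ?thesis"
    then have "inv_into {0<..} \<phi> ?b < inv_into {0<..} \<phi> ?a"
      by (simp add: campbell_cost_def)
    then have "\<phi> (inv_into {0<..} \<phi> ?b) < \<phi> (inv_into {0<..} \<phi> ?a)"
      using inv_into_into[OF a] inv_into_into[OF b] phi
      strict_mono_onD[of "{0<..}" \<phi>]
      by (auto simp: cost_function_def)
    with le f_inv_into_f[OF a] f_inv_into_f[OF b] show False by simp
  qed
qed

text \<open>\<open>opt l i m\<close> is the least contribution to the cost of the symbols \<open>i+1, ..., n\<close> if they
  get codewords of length at least \<open>l\<close> below \<open>m\<close> nodes of depth \<open>l\<close>.  Either symbol \<open>i+1\<close> takes
  one of the nodes, or all of them are split.  More nodes than remaining symbols are useless;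
  this is why \<open>m\<close> is cut off at \<open>n - i\<close>, and why no node is split if \<open>m\<close> has that value.\<close>

function opt :: "nat \<Rightarrow> nat \<Rightarrow> nat \<Rightarrow> real" where
  "opt l i m =
    (if m = 0 \<or> n \<le> i then 0
     else if n - i \<le> m then p (i + 1) * \<phi> (real l) + opt l (i + 1) (m - 1)
     else if m = 1 then opt (l + 1) i (min (2 * m) (n - i))
     else min (p (i + 1) * \<phi> (real l) + opt l (i + 1) (m - 1))
            (opt (l + 1) i (min (2 * m) (n - i))))"
  by auto
termination
  \<comment> \<open>Taking a node lowers \<open>n - i\<close>. Splitting keeps \<open>n - i\<close>,
    but \<open>0 < m < n - i\<close> makes the new node number exceed \<open>m\<close>.\<close>
  by (relation "measures [\<lambda>(l, i, m). n - i, \<lambda>(l, i, m). n - i - m]") auto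

section \<open>The recurrence bounds the cost of every code from below\<close>

declare opt.simps [simp del]

lemma opt_0 [simp]: "opt l i 0 = 0"
  by (simp add: opt.simps)

text \<open>Induction along the recurrence, with Kraft's inequality relative to \<open>m\<close>
  nodes of depth \<open>l\<close> as invariant. If there are enough nodes, length \<open>l\<close>
  is cheapest for symbol \<open>i + 1\<close>. Otherwise, if no remaining symbol has length
  \<open>l\<close>, all nodes can be split; if some symbol has it, an exchange gives this length to
  the most probable symbol \<open>i + 1\<close>.\<close>

lemma opt_le_cost:
  assumes "0 < l" "i < n \<Longrightarrow> 0 < m" "m \<le> n - i"
    and "\<And>k. k \<in> {i+1..n} \<Longrightarrow> l \<le> b k"
    and "(\<Sum>k=i+1..n. (1/2::real) ^ b k) \<le> real m * (1/2) ^ l"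
  shows "opt l i m \<le> (\<Sum>k=i+1..n. p k * \<phi> (real (b k)))"
  using assms
proof (induction l i m arbitrary: b rule: opt.induct)
  case (1 l i m b)
  show ?case
  proof (cases "i < n")
    case False
    then show ?thesis using 1 by (simp add: opt.simps[of l i m])
  next
    case True
    then have m: "0 < m" "m \<le> n - i" using 1 by auto
    have split: "(\<Sum>k=i+1..n. f k) = f (i+1) + (\<Sum>k=i+1+1..n. f k)" for f :: "nat \<Rightarrow> real"
      using True by (simp add: sum.atLeast_Suc_atMost)
    show ?thesis
    proof (cases "n - i \<le> m")
      case full: True
      have "opt l (i+1) (m-1) \<le> (\<Sum>k=i+1+1..n. p k * \<phi> (real (b k)))"
      proof (rule 1(1))
        \<comment> \<open>Here \<open>m = n - i\<close>, so \<open>m - 1\<close> symbols are left,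
          each of weight at most \<open>(1/2) ^ l\<close>.\<close>
        have "(\<Sum>k=i+1+1..n. (1/2::real) ^ b k) \<le> (\<Sum>k=i+1+1..n. (1/2::real) ^ l)"
          using "1.prems" by (intro sum_mono power_decreasing) auto
        also have "\<dots> = real (m - 1) * (1/2) ^ l" using full m by simp
        finally show "(\<Sum>k=i+1+1..n. (1/2::real) ^ b k) \<le> real (m - 1) * (1/2) ^ l" .
      qed (use 1 True m full in auto)
      moreover have "p (i+1) * \<phi> l \<le> p (i+1) * \<phi> (b (i+1))"
        using True "1.prems" by (intro mult_left_mono phi_mono p_nonneg) auto
      moreover have "opt l i m = p (i+1) * \<phi> l + opt l (i+1) (m-1)"
        using True m full by (subst opt.simps) auto
      ultimately show ?thesis unfolding split by linarith
    next
      case nfull: False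
      show ?thesis
      proof (cases "\<exists>k\<in>{i+1..n}. b k = l")
        case False
        have "opt (l+1) i (min (2*m) (n-i)) \<le> (\<Sum>k=i+1..n. p k * \<phi> (real (b k)))"
        proof -
          have b: "l + 1 \<le> b k" if "k \<in> {i+1..n}" for k
            using False "1.prems"(4)[of k] that by (metis Suc_eq_plus1 le_neq_implies_less Suc_leI)
          have "(\<Sum>k=i+1..n. (1/2::real) ^ b k) \<le> (\<Sum>k=i+1..n. (1/2::real) ^ (l+1))"
            using b by (intro sum_mono power_decreasing) auto
          \<comment> \<open>This bound makes the cut-off at \<open>n - i\<close> harmless:
            \<open>n - i\<close> codewords longer than \<open>l\<close> cannot weigh more than
            \<open>n - i\<close> nodes of depth \<open>l + 1\<close>.\<close>
          then have "(\<Sum>k=i+1..n. (1/2::real) ^ b k) \<le> real (n-i) * (1/2) ^ (l+1)" by simp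
          moreover have "(\<Sum>k=i+1..n. (1/2::real) ^ b k) \<le> real (2*m) * (1/2) ^ (l+1)"
            using "1.prems" by simp
          ultimately have s: "(\<Sum>k=i+1..n. (1/2::real) ^ b k) \<le> real (min (2*m) (n-i)) * (1/2) ^ (l+1)"
            unfolding min_def by presburger
          have h: "\<not> (m = 0 \<or> n \<le> i)" using True m by simp
          show ?thesis
          proof (cases "m = 1")
            case True
            show ?thesis by (rule 1(2)[OF h nfull True]) (use b s m h in auto)
          next
            case False
            show ?thesis by (rule 1(4)[OF h nfull False]) (use b s m h in auto)
          qed
        qed
        moreover have "opt l i m \<le> opt (l+1) i (min (2*m) (n-i))"
          using True m nfull by (subst opt.simps) auto
        ultimately show ?thesis by linarith
      next
        case True
        then obtain k where k: "k \<in> {i+1..n}" "b k = l" by blast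
        \<comment> \<open>Exchanging the lengths of \<open>k\<close> and \<open>i+1\<close> does not increase the cost.\<close>
        define b' where "b' = b(k := b (i+1))"
        \<comment> \<open>The exchanged lengths are \<open>b'(i+1 := l)\<close>. The summand is left
          general because both the Kraft sum and the cost are compared.\<close>
        have swap: "(\<Sum>j=i+1..n. f j (b j)) - f k (b k) - f (i+1) (b (i+1)) =
            (\<Sum>j=i+1..n. f j ((b'(i+1 := l)) j)) - f k (b (i+1)) - f (i+1) l"
          if "k \<noteq> i + 1" for f :: "nat \<Rightarrow> nat \<Rightarrow> real"
        proof -
          have e: "(\<Sum>j=i+1..n. g j) - g k - g (i+1) = (\<Sum>j\<in>{i+1..n}-{k}-{i+1}. g j)"
            for g :: "nat \<Rightarrow> real"
            using k that by (simp add: sum_diff1)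
          have "(\<Sum>j\<in>{i+1..n}-{k}-{i+1}. f j (b j)) =
              (\<Sum>j\<in>{i+1..n}-{k}-{i+1}. f j ((b'(i+1 := l)) j))"
            by (intro sum.cong) (auto simp: b'_def)
          then show ?thesis
            using e[of "\<lambda>j. f j (b j)"] e[of "\<lambda>j. f j ((b'(i+1 := l)) j)"] that
            by (simp add: b'_def)
        qed
        have same: "b'(i+1 := l) = b" if "k = i + 1"
          using that k by (auto simp: b'_def)
        have fst_term: "(\<Sum>j=i+1..n. f j ((b'(i+1 := l)) j)) =
            f (i+1) l + (\<Sum>j=i+1+1..n. f j (b' j))" for f :: "nat \<Rightarrow> nat \<Rightarrow> real"
        proof -
          have "(\<Sum>j=i+1+1..n. f j ((b'(i+1 := l)) j)) = (\<Sum>j=i+1+1..n. f j (b' j))"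
            by (intro sum.cong) auto
          then show ?thesis using split[of "\<lambda>j. f j ((b'(i+1 := l)) j)"] by simp
        qed
        have kraft: "(\<Sum>j=i+1..n. (1/2::real) ^ b j) = (1/2) ^ l + (\<Sum>j=i+1+1..n. (1/2) ^ b' j)"
        proof -
          have "(\<Sum>j=i+1..n. (1/2::real) ^ b j) = (\<Sum>j=i+1..n. (1/2) ^ (b'(i+1 := l)) j)"
            using swap[of "\<lambda>_ c. (1/2) ^ c"] k same by (cases "k = i+1") auto
          then show ?thesis using fst_term[of "\<lambda>_ c. (1/2) ^ c"] by (simp only:)
        qed
        have "(p (i+1) - p k) * (\<phi> (b (i+1)) - \<phi> l) \<ge> 0"
          using k "1.prems" sorted[of "i+1" k] by (intro mult_nonneg_nonneg) (auto intro: phi_mono)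
        then have "(\<Sum>j=i+1..n. p j * \<phi> ((b'(i+1 := l)) j)) \<le> (\<Sum>j=i+1..n. p j * \<phi> (b j))"
          using swap[of "\<lambda>j c. p j * \<phi> c"] k same
          by (cases "k = i+1") (auto simp: algebra_simps)
        then have cost: "p (i+1) * \<phi> l + (\<Sum>j=i+1+1..n. p j * \<phi> (b' j)) \<le>
            (\<Sum>j=i+1..n. p j * \<phi> (b j))"
          using fst_term[of "\<lambda>j c. p j * \<phi> (real c)"] by (simp only:)
        have rest: "(\<Sum>j=i+1+1..n. (1/2::real) ^ b' j) \<le> (real m - 1) * (1/2) ^ l"
          using kraft "1.prems" by (simp add: algebra_simps)
        \<comment> \<open>Since \<open>m < n - i\<close>, some symbol after \<open>i + 1\<close>
          remains. Its positive weight must fit below the other \<open>m - 1\<close> nodes, which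
          rules out \<open>m = 1\<close>.\<close>
        have "(\<Sum>j=i+1+1..n. (1/2::real) ^ b' j) > 0"
          using nfull m by (intro sum_pos) auto
        with rest have "(real m - 1) * (1/2) ^ l > 0" by linarith
        then have m2: "1 < m" by (simp add: zero_less_mult_iff)
        have "opt l (i+1) (m-1) \<le> (\<Sum>j=i+1+1..n. p j * \<phi> (b' j))"
        proof (rule 1(3))
          show "l \<le> b' j" if "j \<in> {i+1+1..n}" for j
            using "1.prems"(4)[of j] "1.prems"(4)[of "i+1"] that k by (auto simp: b'_def)
          show "(\<Sum>j=i+1+1..n. (1/2::real) ^ b' j) \<le> real (m - 1) * (1/2) ^ l"
            using rest m by (simp add: of_nat_diff)
        qed (use \<open>i < n\<close> m nfull m2 "1.prems" in auto)
        moreover have "opt l i m \<le> p (i+1) * \<phi> l + opt l (i+1) (m-1)"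
          using \<open>i < n\<close> m m2 by (subst opt.simps) auto
        ultimately show ?thesis using cost by linarith
      qed
    qed
  qed
qed

text \<open>For \<open>n = 1\<close> the invariant demands Kraft sum at most \<open>1/2\<close>;
  this comes from the codeword being nonempty, not from Kraft's inequality.\<close>

lemma opt_le_prefix_code:
  assumes "prefix_code n w"
  shows "opt 1 0 (min 2 n) \<le> (\<Sum>i=1..n. p i * \<phi> (real (length (w i))))"
proof -
  have len: "1 \<le> length (w k)" if "k \<in> {1..n}" for k
    using assms that by (cases "w k") (auto simp: prefix_code_def)
  have "(\<Sum>k=1..n. (1/2::real) ^ length (w k)) \<le> (\<Sum>k=1..n. (1/2::real) ^ 1)"
    using len by (intro sum_mono power_decreasing) auto
  then have "(\<Sum>k=1..n. (1/2::real) ^ length (w k)) \<le> real (min 2 n) * (1/2) ^ 1"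
    using prefix_code_kraft[OF assms] by (auto simp: min_def)
  then show ?thesis
    using opt_le_cost[of 1 0 "min 2 n" "\<lambda>k. length (w k)"] len n_pos by auto
qed

section \<open>An optimal path through the states yields a prefix code\<close>

definition valid :: "nat \<Rightarrow> nat \<Rightarrow> nat \<Rightarrow> bool" where
  "valid l i m \<longleftrightarrow> 1 \<le> l \<and> l \<le> i + m \<and> i + m \<le> n \<and> (m = 0 \<longrightarrow> i = n)"

definition takes_node :: "nat \<Rightarrow> nat \<Rightarrow> nat \<Rightarrow> bool" where
  "takes_node l i m \<longleftrightarrow> n - i \<le> m \<or> 1 < m \<and>
     p (i + 1) * \<phi> (real l) + opt l (i + 1) (m - 1) \<le> opt (l + 1) i (min (2 * m) (n - i))"

lemma opt_take:
  "\<lbrakk>valid l i m; 0 < m; takes_node l i m\<rbrakk> \<Longrightarrow>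
    opt l i m = p (i + 1) * \<phi> (real l) + opt l (i + 1) (m - 1)"
  by (subst opt.simps) (auto simp: valid_def takes_node_def)

lemma opt_split:
  "\<lbrakk>valid l i m; 0 < m; \<not> takes_node l i m\<rbrakk> \<Longrightarrow>
    opt l i m = opt (l + 1) i (min (2 * m) (n - i))"
  by (subst opt.simps) (auto simp: valid_def takes_node_def)

text \<open>The last node is taken only if \<open>n - i <= 1\<close>, so the nodes run out exactly
  when the symbols do.\<close>

lemma valid_take: "\<lbrakk>valid l i m; 0 < m; takes_node l i m\<rbrakk> \<Longrightarrow> valid l (i + 1) (m - 1)"
  by (auto simp: valid_def takes_node_def)

lemma valid_split:
  "\<lbrakk>valid l i m; 0 < m; \<not> takes_node l i m\<rbrakk> \<Longrightarrow> valid (l + 1) i (min (2 * m) (n - i))"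
  by (auto simp: valid_def takes_node_def)

lemma valid_initial: "valid 1 0 (min 2 n)"
  using n_pos by (auto simp: valid_def)

text \<open>The nodes of depth \<open>l\<close> are numbered from left to right; those with numbers in \<open>{c..<2 ^ l}\<close>
  are not below any codeword chosen so far.\<close>

definition partial_code :: "nat \<Rightarrow> nat \<Rightarrow> nat \<Rightarrow> nat \<Rightarrow> (nat \<Rightarrow> bool list) \<Rightarrow> bool" where
  "partial_code l i m c w \<longleftrightarrow> valid l i m \<and> c + m \<le> 2 ^ l \<and> prefix_code i w \<and>
     (\<forall>k\<in>{1..i}. length (w k) \<le> l \<and> (\<forall>x. c \<le> x \<longrightarrow> x < 2 ^ l \<longrightarrow> \<not> prefix (w k) (bits l x))) \<and>
     (\<Sum>k=1..i. p k * \<phi> (real (length (w k)))) + opt l i m = opt 1 0 (min 2 n)"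

lemma partial_code_initial: "partial_code 1 0 (min 2 n) 0 w"
  using valid_initial by (auto simp: partial_code_def prefix_code_def)

text \<open>No earlier codeword is a prefix of the free node \<open>c\<close>. The converse fails
  too, since earlier codewords are no longer than \<open>l\<close>. Later nodes of the same depth
  differ from \<open>c\<close> by injectivity of \<open>bits\<close>, so they stay free.\<close>

lemma partial_code_take:
  assumes "partial_code l i m c w" "0 < m" "takes_node l i m"
  shows "partial_code l (i + 1) (m - 1) (c + 1) (w(i + 1 := bits l c))"
proof -
  let ?w = "w(i + 1 := bits l c)"
  have v: "valid l i m" and c: "c < 2 ^ l" and cm: "c + m \<le> 2 ^ l" and pre: "prefix_code i w"
    and len: "\<And>k. k \<in> {1..i} \<Longrightarrow> length (w k) \<le> l"
    and free: "\<And>k x. k \<in> {1..i} \<Longrightarrow> c \<le> x \<Longrightarrow> x < 2 ^ l \<Longrightarrow> \<not> prefix (w k) (bits l x)"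
    and cost: "(\<Sum>k=1..i. p k * \<phi> (real (length (w k)))) + opt l i m = opt 1 0 (min 2 n)"
    using assms by (auto simp: partial_code_def)
  have l: "0 < l" using v by (simp add: valid_def)
  have new1: "\<not> prefix (w k) (bits l c)" if "k \<in> {1..i}" for k
    using free that c by blast
  have new2: "\<not> prefix (bits l c) (w k)" if "k \<in> {1..i}" for k
  proof
    assume "prefix (bits l c) (w k)"
    then have "bits l c = w k" using len[OF that] by (simp add: prefix_same_length)
    with new1[OF that] show False by simp
  qed
  have "prefix_code (i + 1) ?w"
  proof -
    have "bits l c \<noteq> []" using l length_bits[of l c] by force
    then show ?thesis
      using pre new1 new2 unfolding prefix_code_def
      by (auto simp: atLeastAtMostSuc_conv)
  qed
  moreover have "\<not> prefix (bits l c) (bits l x)" if "c + 1 \<le> x" "x < 2 ^ l" for x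
  proof
    assume "prefix (bits l c) (bits l x)"
    then have "bits l c = bits l x" by (simp add: prefix_same_length)
    then show False using bits_inject[of l c x] that c by simp
  qed
  moreover have "(\<Sum>k=1..i. p k * \<phi> (real (length (?w k)))) =
      (\<Sum>k=1..i. p k * \<phi> (real (length (w k))))"
    by (intro sum.cong) auto
  ultimately show ?thesis
    unfolding partial_code_def
    using valid_take[OF v assms(2,3)] cm \<open>0 < m\<close> len free cost opt_take[OF v assms(2,3)]
    by (auto simp: atLeastAtMostSuc_conv)
qed

text \<open>A codeword of length at most \<open>l\<close> that is a prefix of a node of depth
  \<open>l + 1\<close> is already a prefix of its parent, which was free.\<close>

lemma partial_code_split:
  assumes "partial_code l i m c w" "0 < m" "\<not> takes_node l i m"
  shows "partial_code (l + 1) i (min (2 * m) (n - i)) (2 * c) w"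
proof -
  have v: "valid l i m" and cm: "c + m \<le> 2 ^ l"
    using assms by (auto simp: partial_code_def)
  have "\<not> prefix (w k) (bits (l + 1) x)"
    if k: "k \<in> {1..i}" and x: "2 * c \<le> x" "x < 2 ^ (l + 1)" for k x
  proof
    assume "prefix (w k) (bits (l + 1) x)"
    moreover have "length (w k) \<le> l" using assms k by (auto simp: partial_code_def)
    ultimately have "prefix (w k) (bits l (x div 2))" by (auto simp: prefix_append)
    moreover have "c \<le> x div 2" "x div 2 < 2 ^ l" using x by auto
    ultimately show False using assms k by (auto simp: partial_code_def)
  qed
  then show ?thesis
    unfolding partial_code_def
    using valid_split[OF v assms(2,3)] opt_split[OF v assms(2,3)] assms(1) cm
    by (auto simp: partial_code_def simp del: bits.simps)
qed

lemma partial_code_optimal: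
  assumes "partial_code l i 0 c w"
  shows "optimal_code n p \<phi> w"
proof -
  have i: "i = n" and pre: "prefix_code n w"
    and cost: "(\<Sum>k=1..n. p k * \<phi> (real (length (w k)))) = opt 1 0 (min 2 n)"
    using assms by (auto simp: partial_code_def valid_def)
  have pos: "0 < length (v k)" if "prefix_code n v" "k \<in> {1..n}" for v :: "nat \<Rightarrow> bool list" and k
    using that by (auto simp: prefix_code_def)
  show ?thesis
    unfolding optimal_code_def
  proof (intro conjI allI impI)
    fix v assume v: "prefix_code n v"
    show "campbell_cost n p (\<lambda>i. length (w i)) \<phi> \<le> campbell_cost n p (\<lambda>i. length (v i)) \<phi>"
      using pos[OF pre] pos[OF v] opt_le_prefix_code[OF v] unfolding cost[symmetric]
      by (rule campbell_cost_mono)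
  qed (rule pre)
qed

subsection \<open>Filling the table\<close>

definition N :: nat where "N = n + 1"

text \<open>All valid states have indices below \<open>N ^ 3\<close>. The second half of the range
  keeps the read at depth \<open>n + 1\<close> safe that \<open>take_test\<close> makes when
  \<open>l = n\<close>.\<close>

definition B :: nat where "B = 2 * N ^ 3"

definition enc :: "nat \<Rightarrow> nat \<Rightarrow> nat \<Rightarrow> nat" where
  "enc l i m = (l * N + i) * N + m"

lemma N_ge_2: "2 \<le> N"
  using n_pos by (simp add: N_def)

lemma N_le_B: "N < B"
proof -
  have "N ^ 1 \<le> N ^ 3" using N_ge_2 by (intro power_increasing) auto
  then show ?thesis using N_ge_2 by (simp add: B_def)
qed

lemma B_pos [simp]: "0 < B"
  using N_le_B by simp

lemma enc_less:
  assumes "l \<le> n" "i \<le> n" "m \<le> n"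
  shows "enc l i m < N ^ 3"
proof -
  have "l * N + i < N * N"
    using assms mult_le_mono1[of l "N - 1" N] by (simp add: N_def)
  then have "(l * N + i + 1) * N \<le> (N * N) * N" by (intro mult_le_mono1) simp
  then show ?thesis using assms by (simp add: enc_def N_def power3_eq_cube)
qed

lemma enc_less_B:
  assumes "l \<le> N" "i \<le> n" "m \<le> n"
  shows "enc l i m < B"
proof -
  have "enc l i m \<le> enc n i m + N\<^sup>2"
    using assms mult_le_mono1[of l "n + 1" "N * N"]
    by (simp add: enc_def N_def power2_eq_square algebra_simps)
  also have "\<dots> < N ^ 3 + N ^ 3"
    using enc_less[of n i m] assms N_ge_2 by (intro add_less_le_mono power_increasing) auto
  finally show ?thesis by (simp add: B_def)
qed

lemma enc_decode: "enc (x div N div N) (x div N mod N) (x mod N) = x"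
  by (simp add: enc_def)

lemma decode_enc:
  assumes "i \<le> n" "m \<le> n"
  shows "enc l i m div N div N = l" "enc l i m div N mod N = i" "enc l i m mod N = m"
proof -
  have "enc l i m div N = l * N + i" using assms by (simp add: enc_def N_def del: mult_Suc_right)
  then show "enc l i m div N div N = l" "enc l i m div N mod N = i"
    using assms by (simp_all add: N_def del: mult_Suc_right)
  show "enc l i m mod N = m" using assms by (simp add: enc_def N_def del: mult_Suc_right)
qed

definition input :: "state \<Rightarrow> bool" where
  "input s \<longleftrightarrow> ints s ''n'' 0 = int n \<and> (\<forall>i\<in>{1..n}. reals s ''p'' (int i) = p i)"

definition counters :: "nat \<Rightarrow> nat \<Rightarrow> nat \<Rightarrow> state \<Rightarrow> bool" where
  "counters l i m s \<longleftrightarrow> ints s ''l'' 0 = int l \<and> ints s ''i'' 0 = int i \<and> ints s ''m'' 0 = int m"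

definition table_from :: "nat \<Rightarrow> state \<Rightarrow> bool" where
  "table_from x s \<longleftrightarrow> (\<forall>l i m. valid l i m \<longrightarrow> x \<le> enc l i m \<longrightarrow>
     reals s ''A'' (int (enc l i m)) = opt l i m)"

lemma ival_side: "input s \<Longrightarrow> ival s side = int N"
  by (simp add: side_def input_def N_def)

lemma isafe_side: "isafe B s side"
  by (simp add: side_def)

lemma ival_slot:
  "\<lbrakk>input s; ival s e = int l; ival s f = int i; ival s g = int m\<rbrakk> \<Longrightarrow>
    ival s (slot e f g) = int (enc l i m)"
  by (simp add: slot_def ival_side enc_def)

lemma isafe_slot: "isafe B s (slot e f g) \<longleftrightarrow> isafe B s e \<and> isafe B s f \<and> isafe B s g"
  by (auto simp: slot_def isafe_side)

section \<open>The decision test agrees with the recurrence\<close>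

context
  fixes s l i m
  assumes s: "input s" "counters l i m s" and v: "valid l i m" "0 < m"
begin

lemma rval_take_value:
  "rval \<phi> s take_value = p (i + 1) * \<phi> (real l) + reals s ''A'' (int (enc l (i + 1) (m - 1)))"
proof -
  have "ival s (slot (var ''l'') (IAdd (var ''i'') (IConst 1)) (ISub (var ''m'') (IConst 1))) =
      int (enc l (i + 1) (m - 1))"
    by (rule ival_slot) (use s v in \<open>auto simp: counters_def of_nat_diff\<close>)
  moreover have "reals s ''p'' (int i + 1) = p (i + 1)"
  proof -
    have "i + 1 \<in> {1..n}" using v by (auto simp: valid_def)
    then have "reals s ''p'' (int (i + 1)) = p (i + 1)" using s unfolding input_def by blast
    moreover have "int i + 1 = int (i + 1)" by simp
    ultimately show ?thesis by (simp only:)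
  qed
  ultimately show ?thesis using s by (simp add: take_value_def counters_def)
qed

lemma rsafe_take_value: "rsafe \<phi> B s take_value"
proof -
  have "ival s (slot (var ''l'') (IAdd (var ''i'') (IConst 1)) (ISub (var ''m'') (IConst 1))) =
      int (enc l (i + 1) (m - 1))"
    by (rule ival_slot) (use s v in \<open>auto simp: counters_def of_nat_diff\<close>)
  moreover have "enc l (i + 1) (m - 1) < B"
    using v by (intro enc_less_B) (auto simp: valid_def N_def)
  moreover have "int i + 1 < int B" using N_le_B v by (auto simp: valid_def N_def)
  ultimately show ?thesis
    using s v by (auto simp: take_value_def counters_def isafe_slot valid_def)
qed

context
  assumes k: "ints s ''k'' 0 = int (min (2 * m) (n - i))"
begin

lemma ival_split_slot:
  "ival s (slot (IAdd (var ''l'') (IConst 1)) (var ''i'') (var ''k'')) =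
    int (enc (l + 1) i (min (2 * m) (n - i)))"
  by (rule ival_slot) (use s k in \<open>auto simp: counters_def\<close>)

lemma rval_split_value:
  "rval \<phi> s split_value = reals s ''A'' (int (enc (l + 1) i (min (2 * m) (n - i))))"
  by (simp add: split_value_def ival_split_slot)

lemma rsafe_split_value: "rsafe \<phi> B s split_value"
proof -
  have "enc (l + 1) i (min (2 * m) (n - i)) < B"
    using v by (intro enc_less_B) (auto simp: valid_def N_def)
  then show ?thesis by (simp add: split_value_def ival_split_slot isafe_slot)
qed

lemma bsafe_take_test: "bsafe \<phi> B s take_test"
  by (simp add: take_test_def remaining_def rsafe_take_value rsafe_split_value)

context
  assumes t: "table_from (enc l i m + 1) s"
begin

lemma table_take: "valid l (i + 1) (m - 1) \<Longrightarrow>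
    reals s ''A'' (int (enc l (i + 1) (m - 1))) = opt l (i + 1) (m - 1)"
proof -
  \<comment> \<open>The index increases by \<open>N - 1\<close>, which is positive.\<close>
  have "enc l i m + 1 \<le> enc l (i + 1) (m - 1)"
    using v N_ge_2 by (simp add: enc_def algebra_simps)
  then show "valid l (i + 1) (m - 1) \<Longrightarrow> ?thesis" using t by (simp add: table_from_def)
qed

lemma table_split: "valid (l + 1) i (min (2 * m) (n - i)) \<Longrightarrow>
    reals s ''A'' (int (enc (l + 1) i (min (2 * m) (n - i)))) = opt (l + 1) i (min (2 * m) (n - i))"
proof -
  \<comment> \<open>The index gains \<open>N * N\<close> from the depth and loses at most
    \<open>m\<close>.\<close>
  have "m < N" using v by (auto simp: valid_def N_def)
  also have "N * 1 \<le> N * N" using N_ge_2 by (intro mult_left_mono) auto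
  finally have "enc l i m + 1 \<le> enc (l + 1) i (min (2 * m) (n - i))"
    by (simp add: enc_def algebra_simps)
  then show "valid (l + 1) i (min (2 * m) (n - i)) \<Longrightarrow> ?thesis" using t by (simp add: table_from_def)
qed

lemma bval_take_test: "bval \<phi> s take_test \<longleftrightarrow> takes_node l i m"
proof -
  have i: "i \<le> n" and si: "ints s ''i'' 0 = int i" "ints s ''m'' 0 = int m" "ints s ''n'' 0 = int n"
    using v s by (auto simp: valid_def counters_def input_def)
  show ?thesis
  \<comment> \<open>Only in this case does the comparison of costs matter, and then both successors
    are valid, so their entries are correct. Otherwise the integer comparisons decide.\<close>
  proof (cases "1 < m \<and> m < n - i")
    case True
    then have "valid l (i + 1) (m - 1)" "valid (l + 1) i (min (2 * m) (n - i))"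
      using v by (auto simp: valid_def)
    then have "rval \<phi> s take_value = p (i + 1) * \<phi> (real l) + opt l (i + 1) (m - 1)"
      "rval \<phi> s split_value = opt (l + 1) i (min (2 * m) (n - i))"
      using table_take table_split by (simp_all add: rval_take_value rval_split_value)
    then show ?thesis
      using True i si by (auto simp: take_test_def remaining_def takes_node_def)
  next
    case False
    then show ?thesis
      using i si by (auto simp: take_test_def remaining_def takes_node_def)
  qed
qed

lemma rval_take_value_opt: "takes_node l i m \<Longrightarrow> rval \<phi> s take_value = opt l i m"
  using valid_take[OF v] opt_take[OF v] table_take by (simp add: rval_take_value)

lemma rval_split_value_opt: "\<not> takes_node l i m \<Longrightarrow> rval \<phi> s split_value = opt l i m"
  using valid_split[OF v] opt_split[OF v] table_split by (simp add: rval_split_value)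

end
end
end

lemma wp_cap:
  assumes "input s" "counters l i m s" "i \<le> n"
  shows "wp \<phi> B cap (\<lambda>s'. \<exists>f. s' = s\<lparr>ints := (ints s)(''k'' := f)\<rparr> \<and>
     f 0 = int (min (2 * m) (n - i))) s"
  using assms by (auto simp: cap_def remaining_def counters_def input_def of_nat_diff min_def)

lemma wp_decode:
  assumes "input s" "table_from (Suc x) s" "ints s ''x'' 0 = int (Suc x)"
  shows "wp \<phi> B decode (\<lambda>s'. input s' \<and> table_from (Suc x) s' \<and> ints s' ''x'' 0 = int x \<and>
     emitted s' = emitted s \<and> counters (x div N div N) (x div N mod N) (x mod N) s') s"
proof -
  have n: "int n + 1 = int N" by (simp add: N_def)
  have m: "int y - int N * (int y div int N) = int (y mod N)" for y
    by (metis minus_mult_div_eq_mod zdiv_int zmod_int)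
  show ?thesis
    using assms N_ge_2 m[of x] m[of "x div N"]
    by (simp add: decode_def side_def n input_def table_from_def counters_def zdiv_int zmod_int)
qed

lemma valid_bounds: "valid l i m \<Longrightarrow> l \<le> n \<and> i \<le> n \<and> m \<le> n"
  by (auto simp: valid_def)

lemma valid_test:
  assumes "input s" "counters l i m s"
  shows "bsafe \<phi> B s valid_test" "bval \<phi> s valid_test \<longleftrightarrow> valid l i m \<and> 0 < m"
  using assms by (auto simp: valid_test_def input_def counters_def valid_def)

definition filled :: "nat \<Rightarrow> state \<Rightarrow> bool" where
  "filled x s \<longleftrightarrow> input s \<and> table_from x s \<and> ints s ''x'' 0 = int x \<and> emitted s = []"

lemma wp_fill_entry:
  fixes x
  defines "l \<equiv> x div N div N" and "i \<equiv> x div N mod N" and "m \<equiv> x mod N"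
  assumes s: "input s" "table_from (Suc x) s" "ints s ''x'' 0 = int x" "counters l i m s"
    and em: "emitted s = []" and x: "x < N ^ 3"
  shows "wp \<phi> B (Cond valid_test
    (Seq cap (Cond take_test
      (RWrite ''A'' (var ''x'') take_value) (RWrite ''A'' (var ''x'') split_value)))
    (RWrite ''A'' (var ''x'') (ROfInt (IConst 0)))) (filled x) s"
proof -
  have enc: "enc l i m = x" unfolding l_def i_def m_def by (rule enc_decode)
  have xB: "x < B" using x by (simp add: B_def)
  \<comment> \<open>Only entries of states have to be right, hence the condition on
    \<open>v\<close>; by uniqueness of digits the written index belongs to no other state.\<close>
  have stored: "table_from x s'"
    if v: "valid l i m \<Longrightarrow> v = opt l i m"
      and s': "reals s' = (reals s)(''A'' := (reals s ''A'')(int x := v))" for s' v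
    unfolding table_from_def
  proof (intro allI impI)
    fix l' i' m' assume a: "valid l' i' m'" "x \<le> enc l' i' m'"
    show "reals s' ''A'' (int (enc l' i' m')) = opt l' i' m'"
    proof (cases "x = enc l' i' m'")
      case True
      then have "l = l'" "i = i'" "m = m'"
        using decode_enc[of i' m' l'] valid_bounds[OF a(1)] by (auto simp: l_def i_def m_def)
      then show ?thesis using v a True by (simp add: s')
    next
      case False
      then show ?thesis using a s(2) by (simp add: s' table_from_def)
    qed
  qed
  show ?thesis
  proof (cases "valid l i m \<and> 0 < m")
    case False
    then have "valid l i m \<Longrightarrow> 0 = opt l i m" by auto
    from stored[OF this] show ?thesis
      using False valid_test[OF s(1,4)] xB s(1,3) by (auto simp: filled_def em input_def)
  next
    case True
    then have "i \<le> n" by (auto simp: valid_def)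
    have "wp \<phi> B (Seq cap (Cond take_test
        (RWrite ''A'' (var ''x'') take_value) (RWrite ''A'' (var ''x'') split_value))) (filled x) s"
      unfolding wp.simps(5)
    proof (rule wp_mono[OF wp_cap[OF s(1,4) \<open>i \<le> n\<close>]])
      fix s' assume "\<exists>f. s' = s\<lparr>ints := (ints s)(''k'' := f)\<rparr> \<and> f 0 = int (min (2 * m) (n - i))"
      then obtain f where s': "s' = s\<lparr>ints := (ints s)(''k'' := f)\<rparr>"
        and f: "f 0 = int (min (2 * m) (n - i))" by blast
      have h: "input s'" "counters l i m s'" "valid l i m" "0 < m"
        "ints s' ''k'' 0 = int (min (2 * m) (n - i))" "table_from (enc l i m + 1) s'"
        using s True f by (auto simp: s' input_def counters_def table_from_def enc)
      have goal: "filled x (s'\<lparr>reals := (reals s')(''A'' := (reals s' ''A'')(int x := opt l i m))\<rparr>)"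
        using h(1) s(3) stored[of "opt l i m"] by (auto simp: filled_def s' em input_def)
      have sx: "ints s' ''x'' 0 = int x" using s(3) by (simp add: s')
      show "wp \<phi> B (Cond take_test
          (RWrite ''A'' (var ''x'') take_value) (RWrite ''A'' (var ''x'') split_value)) (filled x) s'"
        using bsafe_take_test[OF h(1-5)] bval_take_test[OF h] rval_take_value_opt[OF h]
          rval_split_value_opt[OF h] rsafe_take_value[OF h(1-4)] rsafe_split_value[OF h(1-5)]
          xB sx goal by simp
    qed
    then show ?thesis using True valid_test[OF s(1,4)] by simp
  qed
qed

lemma wp_fill_body:
  assumes "filled (Suc x) s" "Suc x \<le> N ^ 3"
  shows "wp \<phi> B fill_body (filled x) s"
  unfolding fill_body_def wp.simps(5)[of _ _ decode]
proof (rule wp_mono[OF wp_decode[of s x]])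
  show "input s" "table_from (Suc x) s" "ints s ''x'' 0 = int (Suc x)"
    using assms by (auto simp: filled_def)
qed (rule wp_fill_entry, use assms in \<open>auto simp: filled_def\<close>)

lemma runs_fill:
  assumes "input s" "emitted s = []"
  shows "runs \<phi> B (Seq start_fill fill) s
    (time_bound start_fill + (N ^ 3 + 1) * (btime (is_pos ''x'') + time_bound fill_body + 1))
    (\<lambda>s'. input s' \<and> table_from 0 s' \<and> emitted s' = [])"
proof (rule runs_Seq)
  \<comment> \<open>Vacuous, as every valid state has a smaller index.\<close>
  have "table_from (N ^ 3) s'" for s'
    using enc_less valid_bounds by (fastforce simp: table_from_def)
  then have "wp \<phi> B start_fill (filled (N ^ 3)) s"
    using assms by (auto simp: start_fill_def isafe_side ival_side filled_def input_def power3_eq_cube)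
  then show "runs \<phi> B start_fill s (time_bound start_fill) (filled (N ^ 3))"
    by (rule wp_runs)
next
  fix s' assume s': "filled (N ^ 3) s'"
  let ?I = "\<lambda>s. \<exists>x \<le> N ^ 3. filled x s" and ?b = "is_pos ''x''"
  let ?f = "\<lambda>s. nat (ints s ''x'' 0)"
  have "runs \<phi> B (While ?b fill_body) s' ((?f s' + 1) * (btime ?b + time_bound fill_body + 1))
      (\<lambda>s. ?I s \<and> \<not> bval \<phi> s ?b)"
  proof (rule runs_While)
    show "bsafe \<phi> B s ?b" for s by simp
    show "?I s'" using s' by blast
  next
    fix s assume I: "?I s" "bval \<phi> s ?b"
    then obtain y where y: "y \<le> N ^ 3" "filled y s" by blast
    with I(2) obtain x where x: "y = Suc x" by (cases y) (auto simp: filled_def)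
    show "runs \<phi> B fill_body s (time_bound fill_body) (\<lambda>s'. ?I s' \<and> ?f s' < ?f s)"
      by (rule runs_mono[OF wp_runs[OF wp_fill_body[of x s]]]) (use x y in \<open>auto simp: filled_def\<close>)
  qed
  moreover have "?f s' = N ^ 3" using s' by (simp add: filled_def nat_power_eq)
  ultimately show "runs \<phi> B fill s' ((N ^ 3 + 1) *
      (btime (is_pos ''x'') + time_bound fill_body + 1))
      (\<lambda>s'. input s' \<and> table_from 0 s' \<and> emitted s' = [])"
    unfolding fill_def by (auto elim!: runs_mono simp: filled_def)
qed

subsection \<open>Writing out the code\<close>

lemma runs_emit:
  assumes "ints s ''l'' 0 = int l" "ints s ''c'' 0 = int c"
  shows "runs \<phi> B emit s (emit_time l) (\<lambda>s'. \<exists>f. ints s' = (ints s)(''j'' := f) \<and>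
    reals s' = reals s \<and> emitted s' = emitted s @ int l # map of_bool (bits l c))"
  unfolding emit_def emit_time_def
proof (rule runs_Seq)
  let ?b = "is_pos ''j''"
  \<comment> \<open>With \<open>j\<close> bits still to be written, the output is the numeral of the
    top \<open>l - j\<close> bits, that is, of the ancestor of node \<open>c\<close> at depth
    \<open>l - j\<close>.\<close>
  define I where "I j s' \<longleftrightarrow> j \<le> l \<and> (\<exists>f. f 0 = int j \<and> ints s' = (ints s)(''j'' := f)) \<and>
    reals s' = reals s \<and>
    emitted s' = emitted s @ int l # map of_bool (bits (l - j) (c div 2 ^ j))" for j and s' :: state
  let ?f = "\<lambda>s. nat (ints s ''j'' 0)"
  have "wp \<phi> B (Seq (Emit (var ''l'')) (assign ''j'' (var ''l''))) (I l) s"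
    using assms by (auto simp: I_def intro!: exI[of _ "(ints s ''j'')(0 := int l)"])
  then show "runs \<phi> B (Seq (Emit (var ''l'')) (assign ''j'' (var ''l''))) s
      (time_bound (Seq (Emit (var ''l'')) (assign ''j'' (var ''l'')))) (I l)"
    by (rule wp_runs)
  fix s' assume s': "I l s'"
  have "runs \<phi> B (While ?b emit_body) s' ((?f s' + 1) * (btime ?b + time_bound emit_body + 1))
      (\<lambda>s. (\<exists>j. I j s) \<and> \<not> bval \<phi> s ?b)"
  proof (rule runs_While)
    show "bsafe \<phi> B s ?b" for s by simp
    show "\<exists>j. I j s'" using s' by blast
  next
    fix s1 assume "\<exists>j. I j s1" and b: "bval \<phi> s1 ?b"
    then obtain j where I: "I j s1" by blast
    with b obtain k where k: "j = Suc k" by (cases j) (auto simp: I_def)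
    have j1: "ints s1 ''j'' 0 = int (Suc k)" using I k by (auto simp: I_def)
    have "l - k = Suc (l - Suc k)" using I k by (auto simp: I_def)
    then have bits: "bits (l - k) (c div 2 ^ k) =
        bits (l - Suc k) (c div 2 ^ Suc k) @ [odd (c div 2 ^ k)]"
      by (simp only: power_Suc2 div_mult2_eq bits.simps)
    have "int x - 2 * (int x div 2) = of_bool (odd x)" for x
      by (cases "even x") (auto elim!: evenE oddE)
    then have bit: "int c div 2 ^ k - 2 * (int c div 2 ^ k div 2) = of_bool (odd (c div 2 ^ k))"
      by (metis of_nat_numeral of_nat_power zdiv_int)
    obtain f where "f 0 = int j" "ints s1 = (ints s)(''j'' := f)" using I by (auto simp: I_def)
    then have "wp \<phi> B emit_body (I k) s1"
      using I k assms bit bits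
      by (auto simp: emit_body_def I_def drop_bit_eq_div intro!: exI[of _ "f(0 := int k)"])
    then show "runs \<phi> B emit_body s1 (time_bound emit_body)
        (\<lambda>s'. (\<exists>j. I j s') \<and> ?f s' < ?f s1)"
      by (rule runs_mono[OF wp_runs]) (use j1 in \<open>auto simp: I_def\<close>)
  qed
  moreover have "?f s' = l" using s' by (auto simp: I_def)
  ultimately show "runs \<phi> B (While ?b emit_body) s'
      ((l + 1) * (btime ?b + time_bound emit_body + 1)) (\<lambda>s'. \<exists>f. ints s' = (ints s)(''j'' := f) \<and>
       reals s' = reals s \<and> emitted s' = emitted s @ int l # map of_bool (bits l c))"
    by (auto elim!: runs_mono simp: I_def)
qed

lemma code_output_take:
  "code_output (i + 1) (w(i + 1 := v)) = code_output i w @ int (length v) # map of_bool v"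
proof -
  have "map (\<lambda>k. int (length ((w(i + 1 := v)) k)) # map of_bool ((w(i + 1 := v)) k)) [1..<Suc i] =
      map (\<lambda>k. int (length (w k)) # map of_bool (w k)) [1..<Suc i]"
    by (intro map_cong) auto
  moreover have "[1..<Suc (i + 1)] = [1..<Suc i] @ [i + 1]" by simp
  ultimately show ?thesis
    unfolding code_output_def by (simp only: map_append concat_append) simp
qed

text \<open>The code \<open>w\<close> is a ghost: the program stores no codewords, only the number
  \<open>c\<close> of the leftmost free node.\<close>

definition walking :: "nat \<Rightarrow> nat \<Rightarrow> nat \<Rightarrow> nat \<Rightarrow> (nat \<Rightarrow> bool list) \<Rightarrow> state \<Rightarrow> bool" where
  "walking l i m c w s \<longleftrightarrow> input s \<and> table_from 0 s \<and> counters l i m s \<and>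
     ints s ''c'' 0 = int c \<and> partial_code l i m c w \<and> emitted s = code_output i w"

definition walk_time :: nat where
  "walk_time = time_bound cap + (btime take_test +
     (emit_time n + time_bound take_node + time_bound split_nodes) + 1)"

text \<open>Both moves raise \<open>l + i\<close> by one. The time allowance covers either branch
  and uses \<open>emit_time n\<close> because \<open>l <= n\<close>.\<close>

lemma runs_walk_body:
  assumes "walking l i m c w s" "0 < m"
  shows "runs \<phi> B (Seq cap (Cond take_test (Seq emit take_node) split_nodes)) s walk_time
    (\<lambda>s'. \<exists>l' i' m' c' w'. walking l' i' m' c' w' s' \<and> l + i < l' + i')"
    (is "runs _ _ _ _ _ ?Q")
  unfolding walk_time_def
proof (rule runs_Seq)
  have s: "input s" "table_from 0 s" "counters l i m s" and c: "ints s ''c'' 0 = int c"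
    and pc: "partial_code l i m c w" and em: "emitted s = code_output i w"
    using assms by (auto simp: walking_def)
  have v: "valid l i m" using pc by (simp add: partial_code_def)
  have bounds: "l \<le> n" "i \<le> n" using valid_bounds[OF v] by auto
  let ?R = "\<lambda>s'. \<exists>f. s' = s\<lparr>ints := (ints s)(''k'' := f)\<rparr> \<and> f 0 = int (min (2 * m) (n - i))"
  show "runs \<phi> B cap s (time_bound cap) ?R"
    using s bounds by (intro wp_runs wp_cap)
  fix s' assume "?R s'"
  then obtain f where s': "s' = s\<lparr>ints := (ints s)(''k'' := f)\<rparr>"
    and f: "f 0 = int (min (2 * m) (n - i))" by blast
  have h: "input s'" "counters l i m s'" "valid l i m" "0 < m"
    "ints s' ''k'' 0 = int (min (2 * m) (n - i))" "table_from (enc l i m + 1) s'"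
    using s v assms(2) f by (auto simp: s' input_def counters_def table_from_def)
  show "runs \<phi> B (Cond take_test (Seq emit take_node) split_nodes) s'
      (btime take_test + (emit_time n + time_bound take_node + time_bound split_nodes) + 1) ?Q"
  proof (rule runs_Cond)
    show "bsafe \<phi> B s' take_test" by (rule bsafe_take_test[OF h(1-5)])
  next
    assume "bval \<phi> s' take_test"
    then have t: "takes_node l i m" using bval_take_test[OF h] by simp
    have "emit_time l \<le> emit_time n"
      using bounds unfolding emit_time_def by (intro add_mono mult_le_mono) auto
    moreover have "runs \<phi> B (Seq emit take_node) s' (emit_time l + time_bound take_node) ?Q"
    proof (rule runs_Seq)
      let ?E = "\<lambda>s1 :: state. \<exists>g. ints s1 = (ints s')(''j'' := g) \<and> reals s1 = reals s' \<and>
        emitted s1 = emitted s' @ int l # map of_bool (bits l c)"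
      show "runs \<phi> B emit s' (emit_time l) ?E"
        using s c by (intro runs_emit) (auto simp: s' counters_def)
      fix s1 assume "?E s1"
      then obtain g where s1: "ints s1 = (ints s')(''j'' := g)" "reals s1 = reals s'"
        "emitted s1 = emitted s' @ int l # map of_bool (bits l c)" by blast
      have "code_output (i + 1) (w(i + 1 := bits l c)) =
          emitted s @ int l # map of_bool (bits l c)"
        by (simp only: code_output_take em length_bits)
      then have "wp \<phi> B take_node (walking l (i + 1) (m - 1) (c + 1) (w(i + 1 := bits l c))) s1"
        using s c assms(2) partial_code_take[OF pc assms(2) t]
        by (auto simp: take_node_def s1 s' walking_def input_def table_from_def counters_def of_nat_diff)
      then show "runs \<phi> B take_node s1 (time_bound take_node) ?Q"
        by (rule runs_mono[OF wp_runs]) (fastforce intro: exI)+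
    qed
    ultimately show "runs \<phi> B (Seq emit take_node) s'
        (emit_time n + time_bound take_node + time_bound split_nodes) ?Q"
      by (auto elim: runs_mono)
  next
    assume "\<not> bval \<phi> s' take_test"
    then have t: "\<not> takes_node l i m" using bval_take_test[OF h] by simp
    have "wp \<phi> B split_nodes (walking (l + 1) i (min (2 * m) (n - i)) (2 * c) w) s'"
      using s c em f partial_code_split[OF pc assms(2) t]
      by (auto simp: split_nodes_def s' walking_def input_def table_from_def counters_def)
    then have "runs \<phi> B split_nodes s' (time_bound split_nodes) ?Q"
      by (rule runs_mono[OF wp_runs]) (fastforce intro: exI)+
    then show "runs \<phi> B split_nodes s'
        (emit_time n + time_bound take_node + time_bound split_nodes) ?Q"
      by (auto elim: runs_mono)
  qed
qed

text \<open>Since \<open>l\<close> and \<open>i\<close> never exceed \<open>n\<close>, the measure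
  \<open>2 * n - l - i\<close> bounds the number of rounds.\<close>

lemma runs_walk:
  assumes "walking l i m c w s"
  shows "runs \<phi> B walk s ((2 * n + 1) * (btime (is_pos ''m'') + walk_time + 1))
    (\<lambda>s'. \<exists>l c w. walking l n 0 c w s')"
proof -
  let ?b = "is_pos ''m''"
  let ?I = "\<lambda>s. \<exists>l i m c w. walking l i m c w s"
  define f where "f s = nat (2 * int n - ints s ''l'' 0 - ints s ''i'' 0)" for s :: state
  have f: "f s + l + i = 2 * n" if "walking l i m c w s" for l i m c w s
    using that valid_bounds[of l i m]
    by (auto simp: f_def walking_def counters_def partial_code_def)
  have "runs \<phi> B walk s ((f s + 1) * (btime ?b + walk_time + 1)) (\<lambda>s. ?I s \<and> \<not> bval \<phi> s ?b)"
    unfolding walk_def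
  proof (rule runs_While)
    show "bsafe \<phi> B s ?b" for s by simp
    show "?I s" using assms by blast
  next
    fix s assume "?I s" and b: "bval \<phi> s ?b"
    then obtain l i m c w where I: "walking l i m c w s" by blast
    with b have "0 < m" by (auto simp: walking_def counters_def)
    from runs_walk_body[OF I this]
    show "runs \<phi> B (Seq cap (Cond take_test (Seq emit take_node) split_nodes)) s walk_time
        (\<lambda>s'. ?I s' \<and> f s' < f s)"
    proof (rule runs_mono[OF _ order_refl])
      fix s' assume "\<exists>l' i' m' c' w'. walking l' i' m' c' w' s' \<and> l + i < l' + i'"
      then obtain l' i' m' c' w' where "walking l' i' m' c' w' s'" "l + i < l' + i'" by blast
      then show "?I s' \<and> f s' < f s" using f[OF I] f[of l' i' m' c' w' s'] by fastforce
    qed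
  qed
  then show ?thesis
  proof (rule runs_mono)
    show "(f s + 1) * (btime ?b + walk_time + 1) \<le> (2 * n + 1) * (btime ?b + walk_time + 1)"
      using f[OF assms] by (intro mult_le_mono1) auto
    fix s' assume "?I s' \<and> \<not> bval \<phi> s' ?b"
    then obtain l i m c w where I: "walking l i m c w s'" and "\<not> bval \<phi> s' ?b" by blast
    then have "m = 0" by (auto simp: walking_def counters_def)
    moreover from this I have "i = n" by (auto simp: walking_def partial_code_def valid_def)
    ultimately show "\<exists>l c w. walking l n 0 c w s'" using I by blast
  qed
qed

lemma runs_start_walk:
  assumes "input s" "table_from 0 s" "emitted s = []"
  shows "runs \<phi> B start_walk s (time_bound start_walk)
    (walking 1 0 (min 2 n) 0 (\<lambda>_. []))"
  using assms partial_code_initial N_le_B N_ge_2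
  by (intro wp_runs) (auto simp: start_walk_def walking_def input_def table_from_def counters_def
      code_output_def min_def N_def)

section \<open>Total time and space\<close>

lemma length_output:
  assumes "walking l n 0 c w s"
  shows "length (emitted s) \<le> 2 * n ^ 3"
proof -
  have len: "length (w k) \<le> n" if "k \<in> {1..n}" for k
    using assms that valid_bounds[of l n 0] by (force simp: walking_def partial_code_def)
  have "length (emitted s) = (\<Sum>k\<leftarrow>[1..<Suc n]. length (w k) + 1)"
    using assms by (simp add: walking_def code_output_def length_concat comp_def)
  also have "\<dots> = (\<Sum>k=1..n. length (w k) + 1)"
    by (simp only: sum_set_upt_conv_sum_list_nat[symmetric] set_upt atLeastLessThanSuc_atLeastAtMost)
  also have "\<dots> \<le> (\<Sum>k=1..n. n + 1)" using len by (intro sum_mono) auto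
  also have "\<dots> \<le> n * (2 * n)" using n_pos by simp
  also have "\<dots> \<le> 2 * n ^ 3"
    using n_pos power_increasing[of 2 3 n] by (simp add: power2_eq_square)
  finally show ?thesis .
qed

text \<open>The pass over the table takes cubic and the walk quadratic time, since each of the
  linearly many rounds writes at most one codeword of length at most \<open>n\<close>.\<close>

lemma time_le:
  "(time_bound start_fill + (N ^ 3 + 1) * (btime (is_pos ''x'') + time_bound fill_body + 1)) +
   (time_bound start_walk + (2 * n + 1) * (btime (is_pos ''m'') + walk_time + 1))
    \<le> time_constant * n ^ 4"
proof -
  define a where "a = time_bound start_fill"
  define b where "b = btime (is_pos ''x'') + time_bound fill_body + 1"
  define c where "c = time_bound start_walk"
  define d where "d = btime (is_pos ''m'') + time_bound cap + btime take_test +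
    emit_time 1 + time_bound take_node + time_bound split_nodes + 2"
  have n4: "1 \<le> n ^ 4" "n ^ 3 \<le> n ^ 4" "n ^ 2 \<le> n ^ 4"
    using n_pos by (auto intro: power_increasing)
  have "N ^ 3 \<le> (2 * n) ^ 3" using n_pos by (intro power_mono) (auto simp: N_def)
  then have N3: "N ^ 3 + 1 \<le> 9 * n ^ 4" using n4 by (simp add: power_mult_distrib)
  have emit: "emit_time n \<le> emit_time 1 * n"
  proof -
    \<comment> \<open>An affine bound in \<open>n\<close> is at most \<open>n\<close> times its
      value at \<open>n = 1\<close>.\<close>
    have "x + (n + 1) * y \<le> (x + 2 * y) * n" for x y :: nat
    proof -
      have "x * 1 + (n + 1) * y \<le> x * n + (2 * n) * y"
        using n_pos by (intro add_mono mult_le_mono) auto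
      then show ?thesis by (simp add: algebra_simps)
    qed
    then show ?thesis unfolding emit_time_def by (simp only: one_add_one)
  qed
  have lift: "x \<le> x * n" for x :: nat using n_pos by simp
  have "btime (is_pos ''m'') + walk_time + 1 \<le> d * n"
    using emit lift[of "btime (is_pos ''m'') + time_bound cap + btime take_test +
      time_bound take_node + time_bound split_nodes + 2"]
    unfolding walk_time_def d_def by (simp only: add_mult_distrib)
  then have "(2 * n + 1) * (btime (is_pos ''m'') + walk_time + 1) \<le> (3 * n) * (d * n)"
    using n_pos by (intro mult_le_mono) auto
  also have "\<dots> = 3 * d * n ^ 2" by (simp add: power2_eq_square)
  also have "\<dots> \<le> 3 * d * n ^ 4" using n4 by (intro mult_left_mono) auto
  finally have w: "(2 * n + 1) * (btime (is_pos ''m'') + walk_time + 1) \<le> 3 * d * n ^ 4" .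
  have f: "(N ^ 3 + 1) * b \<le> 9 * b * n ^ 4"
    using mult_le_mono1[OF N3, of b] by (simp add: mult.commute mult.left_commute)
  have "a \<le> a * n ^ 4" "c \<le> c * n ^ 4" using n4 by simp_all
  with w f have "(a + (N ^ 3 + 1) * b) + (c + (2 * n + 1) * (btime (is_pos ''m'') + walk_time + 1))
      \<le> a * n ^ 4 + 9 * b * n ^ 4 + (c * n ^ 4 + 3 * d * n ^ 4)"
    by linarith
  also have "\<dots> = (a + 9 * b + c + 3 * d) * n ^ 4" by (simp add: algebra_simps)
  finally show ?thesis unfolding time_constant_def a_def b_def c_def d_def .
qed

lemma runs_campbell_program:
  "runs \<phi> B campbell_program (initial_state n p) (time_constant * n ^ 4)
    (\<lambda>s. \<exists>l c w. walking l n 0 c w s)"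
proof (rule runs_mono[OF _ time_le])
  have init: "input (initial_state n p)" "emitted (initial_state n p) = []"
    by (auto simp: input_def initial_state_def)
  show "runs \<phi> B campbell_program (initial_state n p)
    ((time_bound start_fill + (N ^ 3 + 1) * (btime (is_pos ''x'') + time_bound fill_body + 1)) +
     (time_bound start_walk + (2 * n + 1) * (btime (is_pos ''m'') + walk_time + 1)))
    (\<lambda>s. \<exists>l c w. walking l n 0 c w s)"
    unfolding campbell_program_def
    by (rule runs_Seq[OF runs_fill[OF init]], elim conjE, rule runs_Seq[OF runs_start_walk])
      (assumption | rule runs_walk)+
qed

lemma outputs_optimal_code:
  "\<exists>w. optimal_code n p \<phi> w \<and> outputs_code_within \<phi> campbell_program n p
    (real time_constant * real n ^ 4)
    (real (16 * (card (iarrays campbell_program) + card (rarrays campbell_program)) + 2) * real n ^ 3) w"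
proof -
  let ?K = "card (iarrays campbell_program) + card (rarrays campbell_program)"
  from runs_campbell_program obtain t s l c w where
    ex: "exec \<phi> B campbell_program (initial_state n p) t s" and t: "t \<le> time_constant * n ^ 4"
    and w: "walking l n 0 c w s"
    unfolding runs_def by blast
  \<comment> \<open>From \<open>N <= 2 * n\<close> the array length \<open>2 * N ^ 3\<close> is at
    most \<open>16 * n ^ 3\<close>; the output adds at most \<open>2 * n ^ 3\<close>.\<close>
  have "N ^ 3 \<le> (2 * n) ^ 3" using n_pos by (intro power_mono) (auto simp: N_def)
  then have "B \<le> 16 * n ^ 3" by (simp add: B_def power_mult_distrib)
  then have "?K * B + length (emitted s) \<le> ?K * (16 * n ^ 3) + 2 * n ^ 3"
    using length_output[OF w] by (intro add_mono mult_left_mono) auto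
  also have "\<dots> = (16 * ?K + 2) * n ^ 3" by (simp add: algebra_simps)
  finally have "real (?K * B + length (emitted s)) \<le> real ((16 * ?K + 2) * n ^ 3)"
    by (rule of_nat_mono)
  moreover have "real t \<le> real (time_constant * n ^ 4)" using t by (rule of_nat_mono)
  moreover have "emitted s = code_output n w" and "optimal_code n p \<phi> w"
    using w partial_code_optimal by (auto simp: walking_def)
  ultimately show ?thesis
    unfolding outputs_code_within_def
    by (intro exI[of _ w] conjI exI[of _ B] exI[of _ t] exI[of _ s] ex)
      (simp_all add: algebra_simps)
qed

end

theorem mainTheorem3:
  fixes \<phi> :: "real \<Rightarrow> real"
  assumes "cost_function \<phi>"
  shows "\<exists>(c :: program) (T :: nat \<Rightarrow> real) (S :: nat \<Rightarrow> real).
    T \<in> O(\<lambda>n. real n ^ 4) \<and> S \<in> O(\<lambda>n. real n ^ 3) \<and>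
    (\<forall>(n :: nat) (p :: nat \<Rightarrow> real).
       n \<ge> 1 \<longrightarrow> prob_vector n p \<longrightarrow>
       (\<forall>i\<in>{1..n}. \<forall>j\<in>{1..n}. i \<le> j \<longrightarrow> p j \<le> p i) \<longrightarrow> p n > 0 \<longrightarrow>
       (\<exists>w. optimal_code n p \<phi> w \<and> outputs_code_within \<phi> c n p (T n) (S n) w))"
proof (rule exI[of _ campbell_program], rule exI, rule exI, intro conjI allI impI)
  let ?K = "card (iarrays campbell_program) + card (rarrays campbell_program)"
  show "(\<lambda>n. real time_constant * real n ^ 4) \<in> O(\<lambda>n. real n ^ 4)"
    "(\<lambda>n. real (16 * ?K + 2) * real n ^ 3) \<in> O(\<lambda>n. real n ^ 3)"
    by simp_all
  fix n :: nat and p :: "nat \<Rightarrow> real"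
  assume "n \<ge> 1" "prob_vector n p" "\<forall>i\<in>{1..n}. \<forall>j\<in>{1..n}. i \<le> j \<longrightarrow> p j \<le> p i"
  with assms interpret campbell_problem \<phi> n p by unfold_locales auto
  show "\<exists>w. optimal_code n p \<phi> w \<and> outputs_code_within \<phi> campbell_program n p
      (real time_constant * real n ^ 4) (real (16 * ?K + 2) * real n ^ 3) w"
    by (rule outputs_optimal_code)
qed

end
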